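(* Let $f$ be an analytic function (or a polynomial) defined in a neighborhood of the origin of $\mathbb C^n$, with $f(\mathbf 0)=0$, $f\not\equiv 0$. Assume that $f$ is non-degenerate and strongly inv-tame. Then $$\theta_0(f)\le \max\{L,\widetilde\theta\},$$ where $$\widetilde\theta:=\max\{1-\hat p_{min}'\mid \hat P\in\mathcal W_+\cup\mathcal W_v,\ \dim\Delta(P)=n-1\},\qquad L:=\max\{1-1/|\nu(P)|\ \mid\ [P]\in\mathcal D\}.$$
   Context: Łojasiewicz exponent: $\partial f=(\partial f/\partial z_1,\dots,\partial f/\partial z_n)$, and $\theta_0(f)$ is the infimum of all $\theta\in[0,1)$ for which there exist $c>0$ and a neighborhood $U$ of $\mathbf 0$ with $\|\partial f(\mathbf z)\|\ge c|f(\mathbf z)|^\theta$ for all $\mathbf z\in U$. Newton polyhedron: write $f(\mathbf z)=\sum_\nu c_\nu\mathbf z^\nu$. $\Gamma_+(f)$ is the convex hull of $\bigcup_{c_\nu\ne0}(\nu+\mathbb R_+^n)$. Weight vectors are $P=(p_1,\dots,p_n)\in\mathbb R^n$ with all $p_i\ge0$. Put $\ell_P(\nu)=\sum_i p_i\nu_i$; $d(P)$ is the minimum of $\ell_P$ on $\Gamma_+(f)$; $\Delta(P)$ is the (possibly non-compact) face of $\Gamma_+(f)$ where the minimum is attained; $f_P(\mathbf z)=\sum_{\nu\in\Delta(P)}c_\nu\mathbf z^\nu$. $P,Q$ are equivalent if $\Delta(P)=\Delta(Q)$; $[P]$ is the equivalence class of $P$, and $\dim[P]=n-\dim\Delta(P)$.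 Write $Q\succ P$ if $\Delta(Q)\supsetneq\Delta(P)$. Put $I(P)=\{i\mid p_i=0\}$. $\mathcal W_+$ is the set of strictly positive weight vectors ($I(P)=\emptyset$); $\mathcal W_v$ is the set of vanishing weight vectors, i.e. those with $I(P)\neq\emptyset$ and $d(P)>0$. For $P\in\mathcal W_+\cup\mathcal W_v$ (so $d(P)>0$), the normalized weight vector is $\hat P=(\hat p_1,\dots,\hat p_n)=P/d(P)$. $\mathrm{Var}(P)=\{j\mid \partial f_P/\partial z_j\not\equiv0\}$. $\widetilde I(P)=\bigcup\{I(Q)\mid Q\in\mathcal W_v,\ Q\succ P\text{ or }[Q]=[P]\}$. $\widetilde{\mathrm{Var}}(P)=\mathrm{Var}(P)\setminus\widetilde I(P)$. $\hat p_{min}'=\min\{\hat p_j\mid j\in\widetilde{\mathrm{Var}}(P)\}$. $\mathbb C^{*n}=\{\mathbf z\in\mathbb C^n\mid z_i\ne0\ \forall i\}$ and, for $I\subset\{1,\dots,n\}$, $\mathbb C^{*I}=\{\mathbf z\in\mathbb C^n\mid z_j=0\iff j\notin I\}$; $\mathbf z_I=(z_i)_{i\in I}$. $f$ is non-degenerate if $f_P:\mathbb C^{*n}\to\mathbb C$ has no critical point for every $P\in\mathcal W_+$. $f$ is strongly inv-tame if for every $P\in\mathcal W_+\cup\mathcal W_v$ with $\dim\Delta(P)\ge1$: $\widetilde{\mathrm{Var}}(P)\neq\emptyset$, and $f_P:\mathbb C^{*n}\to\mathbb C$ has no critical point as a function of the variables $\{z_j\mid j\in\widetilde{\mathrm{Var}}(P)\}$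 for any fixed $\mathbf z_{\widetilde I(P)}\in\mathbb C^{*\widetilde I(P)}$ (i.e. for each $\mathbf a\in\mathbb C^{*n}$ there is $j\in\widetilde{\mathrm{Var}}(P)$ with $\frac{\partial f_P}{\partial z_j}(\mathbf a)\neq0$). $\mathcal D$ is the set of equivalence classes $[P]$ with $\dim[P]=n$; for $[P]\in\mathcal D$, $\Delta(P)$ is a vertex, $f_P(\mathbf z)=c\,\mathbf z^{\nu(P)}$ is a monomial, and $|\nu(P)|$ is its total degree. *)

theory Defs
  imports "HOL-Analysis.Analysis"
begin

definition monomial :: "nat ^ 'n \<Rightarrow> complex ^ 'n \<Rightarrow> complex" where
  "monomial \<nu> z = (\<Prod>i\<in>UNIV. (z $ i) ^ (\<nu> $ i))"

(* The germ of f at the origin is analytic with Taylor coefficients c; has_sum on complex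
   numbers is absolute convergence. *)
definition has_power_series :: "(complex ^ 'n \<Rightarrow> complex) \<Rightarrow> (nat ^ 'n \<Rightarrow> complex) \<Rightarrow> bool" where
  "has_power_series f c \<longleftrightarrow> (\<forall>\<^sub>F z in nhds 0. ((\<lambda>\<nu>. c \<nu> * monomial \<nu> z) has_sum f z) UNIV)"

definition partial :: "(complex ^ 'n \<Rightarrow> complex) \<Rightarrow> 'n \<Rightarrow> complex ^ 'n \<Rightarrow> complex" where
  "partial g j z = deriv (\<lambda>w. g (\<chi> i. if i = j then w else z $ i)) (z $ j)"

definition gradient :: "(complex ^ 'n \<Rightarrow> complex) \<Rightarrow> complex ^ 'n \<Rightarrow> complex ^ 'n" where
  "gradient g z = (\<chi> j. partial g j z)"

(* The infimum is taken in ereal, so that it is \<infinity> if no exponent is admissible.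
   HOL has 0 powr 0 = 0; for an analytic germ f that is not identically zero this gives the same
   admissible exponents as 0^0 = 1, since gradient f is continuous and the zero set of f is
   nowhere dense near the origin. *)
definition lojasiewicz_exponent :: "(complex ^ 'n \<Rightarrow> complex) \<Rightarrow> ereal" where
  "lojasiewicz_exponent f =
     (INF \<theta>\<in>{\<theta>::real. 0 \<le> \<theta> \<and> \<theta> < 1 \<and>
        (\<exists>K>0. \<forall>\<^sub>F z in nhds 0. norm (gradient f z) \<ge> K * norm (f z) powr \<theta>)}. ereal \<theta>)"

definition real_exponent :: "nat ^ 'n \<Rightarrow> real ^ 'n" where
  "real_exponent \<nu> = (\<chi> i. real (\<nu> $ i))"

definition newton_polyhedron :: "(nat ^ 'n \<Rightarrow> complex) \<Rightarrow> (real ^ 'n) set" where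
  "newton_polyhedron c =
     convex hull (\<Union>\<nu>\<in>{\<nu>. c \<nu> \<noteq> 0}. {real_exponent \<nu> + x | x. \<forall>i. 0 \<le> x $ i})"

definition weights :: "(real ^ 'n) set" where
  "weights = {P. \<forall>i. 0 \<le> P $ i}"

(* The infimum is attained when P is a weight vector and c is not identically zero. *)
definition min_weight :: "(nat ^ 'n \<Rightarrow> complex) \<Rightarrow> real ^ 'n \<Rightarrow> real" where
  "min_weight c P = (INF x\<in>newton_polyhedron c. P \<bullet> x)"

definition face :: "(nat ^ 'n \<Rightarrow> complex) \<Rightarrow> real ^ 'n \<Rightarrow> (real ^ 'n) set" where
  "face c P = {x \<in> newton_polyhedron c. P \<bullet> x = min_weight c P}"

definition face_exponents :: "(nat ^ 'n \<Rightarrow> complex) \<Rightarrow> real ^ 'n \<Rightarrow> (nat ^ 'n) set" where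
  "face_exponents c P = {\<nu>. real_exponent \<nu> \<in> face c P}"

definition face_fun :: "(nat ^ 'n \<Rightarrow> complex) \<Rightarrow> real ^ 'n \<Rightarrow> complex ^ 'n \<Rightarrow> complex" where
  "face_fun c P z = (\<Sum>\<^sub>\<infinity>\<nu>\<in>face_exponents c P. c \<nu> * monomial \<nu> z)"

(* The domain of convergence of face_fun c P.  It is the whole space if the face is compact
   (in particular if P is strictly positive) or if c has finite support. *)
definition face_domain :: "(nat ^ 'n \<Rightarrow> complex) \<Rightarrow> real ^ 'n \<Rightarrow> (complex ^ 'n) set" where
  "face_domain c P =
     interior {z. (\<lambda>\<nu>. c \<nu> * monomial \<nu> z) summable_on face_exponents c P}"

definition weight_class :: "(nat ^ 'n \<Rightarrow> complex) \<Rightarrow> real ^ 'n \<Rightarrow> (real ^ 'n) set" where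
  "weight_class c P = {Q \<in> weights. face c Q = face c P}"

definition class_dim :: "(nat ^ 'n \<Rightarrow> complex) \<Rightarrow> real ^ 'n \<Rightarrow> int" where
  "class_dim c P = int CARD('n) - aff_dim (face c P)"

definition vanishing_indices :: "real ^ 'n \<Rightarrow> 'n set" where
  "vanishing_indices P = {i. P $ i = 0}"

definition positive_weights :: "(real ^ 'n) set" where
  "positive_weights = {P \<in> weights. vanishing_indices P = {}}"

definition vanishing_weights :: "(nat ^ 'n \<Rightarrow> complex) \<Rightarrow> (real ^ 'n) set" where
  "vanishing_weights c = {P \<in> weights. vanishing_indices P \<noteq> {} \<and> min_weight c P > 0}"

definition normalized :: "(nat ^ 'n \<Rightarrow> complex) \<Rightarrow> real ^ 'n \<Rightarrow> real ^ 'n" where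
  "normalized c P = (1 / min_weight c P) *\<^sub>R P"

definition face_vars :: "(nat ^ 'n \<Rightarrow> complex) \<Rightarrow> real ^ 'n \<Rightarrow> 'n set" where
  "face_vars c P = {j. \<exists>z\<in>face_domain c P. partial (face_fun c P) j z \<noteq> 0}"

definition ext_vanishing_indices :: "(nat ^ 'n \<Rightarrow> complex) \<Rightarrow> real ^ 'n \<Rightarrow> 'n set" where
  "ext_vanishing_indices c P =
     \<Union> {vanishing_indices Q | Q. Q \<in> vanishing_weights c \<and>
         (face c P \<subset> face c Q \<or> weight_class c Q = weight_class c P)}"

definition reduced_vars :: "(nat ^ 'n \<Rightarrow> complex) \<Rightarrow> real ^ 'n \<Rightarrow> 'n set" where
  "reduced_vars c P = face_vars c P - ext_vanishing_indices c P"

definition min_reduced_weight :: "(nat ^ 'n \<Rightarrow> complex) \<Rightarrow> real ^ 'n \<Rightarrow> real" where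
  "min_reduced_weight c P = Min ((\<lambda>j. normalized c P $ j) ` reduced_vars c P)"

definition torus :: "(complex ^ 'n) set" where
  "torus = {z. \<forall>i. z $ i \<noteq> 0}"

definition nondegenerate :: "(nat ^ 'n \<Rightarrow> complex) \<Rightarrow> bool" where
  "nondegenerate c \<longleftrightarrow>
     (\<forall>P\<in>positive_weights. \<forall>a\<in>torus. \<exists>j. partial (face_fun c P) j a \<noteq> 0)"

(* For a vanishing weight vector and a non-polynomial f the face function is only defined on
   its domain of convergence, so only points of that domain are considered. *)
definition strongly_inv_tame :: "(nat ^ 'n \<Rightarrow> complex) \<Rightarrow> bool" where
  "strongly_inv_tame c \<longleftrightarrow>
     (\<forall>P\<in>positive_weights \<union> vanishing_weights c. aff_dim (face c P) \<ge> 1 \<longrightarrow>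
        reduced_vars c P \<noteq> {} \<and>
        (\<forall>a\<in>torus \<inter> face_domain c P.
           \<exists>j\<in>reduced_vars c P. partial (face_fun c P) j a \<noteq> 0))"

definition vertex_classes :: "(nat ^ 'n \<Rightarrow> complex) \<Rightarrow> (real ^ 'n) set set" where
  "vertex_classes c = {weight_class c P | P. P \<in> weights \<and> class_dim c P = int CARD('n)}"

(* The exponent of the monomial face_fun c P is the vertex \<nu> of the Newton polyhedron. *)
definition vertex_bound :: "(nat ^ 'n \<Rightarrow> complex) \<Rightarrow> real" where
  "vertex_bound c =
     Max {1 - 1 / real (\<Sum>i\<in>UNIV. \<nu> $ i) | P \<nu>.
       P \<in> weights \<and> weight_class c P \<in> vertex_classes c \<and> face c P = {real_exponent \<nu>}}"

definition facet_bound :: "(nat ^ 'n \<Rightarrow> complex) \<Rightarrow> real" where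
  "facet_bound c =
     Max {1 - min_reduced_weight c P | P.
       P \<in> positive_weights \<union> vanishing_weights c \<and> aff_dim (face c P) = int CARD('n) - 1}"

end

theory Submission
  imports Defs "HOL-Complex_Analysis.Cauchy_Integral_Formula"
begin

text \<open>
  The inequality \<open>K |f|\<^sup>\<theta> \<le> |\<partial>f|\<close> with \<open>\<theta> = max (vertex_bound c) (facet_bound c)\<close> is proved by
  looking at a hypothetical sequence \<open>z\<^sub>k \<longlonglongrightarrow> 0\<close> along which it fails with constants \<open>K \<longlonglongrightarrow> 0\<close>. By continuity
  of \<open>f\<close> and \<open>\<partial>f\<close> the sequence may be taken in the torus. The usual next step is to replace it by an
  analytic arc \<open>z\<^sub>i(t) = b\<^sub>i t^p\<^sub>i + \<dots>\<close> (curve selection); here logarithmic coordinates do the same for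
  the sequence itself.

  By Dickson's lemma finitely many exponents \<open>V\<close> generate the Newton polyhedron. After passing to a
  subsequence, the monomials \<open>z\<^sub>k\<^sup>v\<close>, \<open>v \<in> V\<close>, are comparable in size for \<open>v\<close> in a nonempty set
  \<open>S \<subseteq> V\<close>, and the others are negligible against them. Project \<open>x\<^sub>k = -ln |z\<^sub>k|\<close> to the orthogonal
  complement of the differences of elements of \<open>S\<close>. This changes \<open>x\<^sub>k\<close> by a convergent amount only, and the projection \<open>P\<^sub>k\<close> is
  eventually a positive weight vector whose face is spanned by \<open>S\<close>. Hence \<open>z\<^sub>k = a\<^sub>k exp (-P\<^sub>k)\<close> with
  \<open>a\<^sub>k \<longlonglongrightarrow> b\<close> in the torus (lemma \<open>toric_limit\<close>). Both \<open>f\<close> and the logarithmic derivatives \<open>z\<^sub>j \<partial>\<^sub>jf\<close>, scaled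
  by \<open>exp (d(P\<^sub>k))\<close>, converge to the corresponding expressions of the face function at \<open>b\<close>
  (lemma \<open>pseries_tendsto_initial_form\<close>). So \<open>|f(z\<^sub>k)| = O(exp (-d(P\<^sub>k)))\<close>, while \<open>|\<partial>\<^sub>jf(z\<^sub>k)|\<close> is at least
  of the order \<open>exp (P\<^sub>k\<^sub>j - d(P\<^sub>k))\<close> for every \<open>j\<close> with \<open>\<partial>\<^sub>jf\<^sub>P(b) \<noteq> 0\<close>. The inequality, and with it a
  contradiction, follows once such a \<open>j\<close> exists with \<open>P\<^sub>k\<^sub>j \<ge> (1 - \<theta>) d(P\<^sub>k)\<close>.

  This last statement (lemma \<open>tame_weight_bound\<close>) is combinatorial. If the face of \<open>P\<close> is a vertex \<open>\<nu>\<close>,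
  \<open>\<partial>\<^sub>j z\<^sup>\<nu>\<close> has no zero in the torus whenever \<open>\<nu>\<^sub>j > 0\<close>, and the largest of these \<open>P\<^sub>j\<close> is at least \<open>d(P) / |\<nu>|\<close>. Otherwise
  strong inv-tameness gives \<open>j\<close> among the reduced variables. Minimising the \<open>j\<close>-th coordinate over the
  polyhedron of normalised weights whose face contains that of \<open>P\<close> leads to a vertex of this
  polyhedron, that is, to a facet weight \<open>Q\<close> (lemma \<open>facet_below_weight\<close>). As the face grows from \<open>P\<close> to \<open>Q\<close>,
  \<open>j\<close> stays a reduced variable, so \<open>P\<^sub>j / d(P) \<ge> Q\<^sub>j \<ge> 1 - facet_bound c\<close>.
\<close>

section \<open>Common subsequences and Dickson's lemma\<close>

text \<open>Properties that pass to subsequences, and that can each be achieved by a subsequence, can be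
  achieved simultaneously if there are finitely many. This serves both Dickson's lemma and the
  compactness argument for sequences in the torus.\<close>

lemma common_subsequence:
  fixes R :: "'i \<Rightarrow> (nat \<Rightarrow> nat) \<Rightarrow> bool"
  assumes "finite I"
    and sub: "\<And>i (\<phi>::nat \<Rightarrow> nat) (\<psi>::nat \<Rightarrow> nat). strict_mono \<phi> \<Longrightarrow> strict_mono \<psi> \<Longrightarrow> R i \<phi> \<Longrightarrow> R i (\<phi> \<circ> \<psi>)"
    and ex: "\<And>i (\<phi>::nat \<Rightarrow> nat). i \<in> I \<Longrightarrow> strict_mono \<phi> \<Longrightarrow> \<exists>\<psi>::nat \<Rightarrow> nat. strict_mono \<psi> \<and> R i (\<phi> \<circ> \<psi>)"
  shows "\<exists>\<phi>. strict_mono \<phi> \<and> (\<forall>i\<in>I. R i \<phi>)"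
  using assms(1) ex
proof (induction I rule: finite_induct)
  case empty
  show ?case by (intro exI[of _ id]) (simp add: strict_mono_def)
next
  case (insert i I)
  have "\<exists>\<phi>. strict_mono \<phi> \<and> (\<forall>i\<in>I. R i \<phi>)"
    by (rule insert.IH) (rule insert.prems, simp)
  then obtain \<phi> where \<phi>: "strict_mono \<phi>" "\<forall>i\<in>I. R i \<phi>" by blast
  from insert.prems[OF insertI1 \<phi>(1)] obtain \<psi> where \<psi>: "strict_mono \<psi>" "R i (\<phi> \<circ> \<psi>)" by blast
  show ?case
    using \<phi>(2) \<psi>(2) sub[OF \<phi>(1) \<psi>(1)] strict_mono_o[OF \<phi>(1) \<psi>(1)]
    by (intro exI[of _ "\<phi> \<circ> \<psi>"] conjI ballI) blast+
qed

lemma nat_seq_incseq_subsequence: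
  fixes x :: "nat \<Rightarrow> nat"
  shows "\<exists>\<psi>. strict_mono \<psi> \<and> incseq (x \<circ> \<psi>)"
proof -
  obtain \<psi> where \<psi>: "strict_mono \<psi>" "monoseq (\<lambda>n. x (\<psi> n))" using seq_monosub by blast
  show ?thesis
  proof (cases "incseq (\<lambda>n. x (\<psi> n))")
    case True
    with \<psi> show ?thesis by (auto simp: comp_def)
  next
    case False
    with \<psi>(2) have dec: "decseq (\<lambda>n. x (\<psi> n))" by (simp add: monoseq_iff)
    \<comment> \<open>A nonincreasing sequence of natural numbers is constant from its minimum on.\<close>
    obtain m where m: "\<And>n. x (\<psi> m) \<le> x (\<psi> n)"
      using ex_has_least_nat[of "\<lambda>_. True" 0 "\<lambda>n. x (\<psi> n)"] by auto
    have c: "x (\<psi> (m + n)) = x (\<psi> m)" for n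
      using decseqD[OF dec, of m "m + n"] m[of "m + n"] by simp
    have "strict_mono (\<lambda>n. \<psi> (m + n))" using \<psi>(1) by (simp add: strict_mono_def)
    then show ?thesis
      by (intro exI[of _ "\<lambda>n. \<psi> (m + n)"]) (auto simp: incseq_def c)
  qed
qed

text \<open>Otherwise one could choose exponents one after the other, none dominating an earlier one. But a
  subsequence is nondecreasing in every coordinate.\<close>

lemma dickson:
  fixes A :: "(nat ^ 'n) set"
  shows "\<exists>V. finite V \<and> V \<subseteq> A \<and> (\<forall>\<nu>\<in>A. \<exists>v\<in>V. \<forall>i. v $ i \<le> \<nu> $ i)"
proof (rule ccontr)
  assume no: "\<not> ?thesis"
  define pick where "pick V = (SOME \<nu>. \<nu> \<in> A \<and> (\<forall>v\<in>V. \<not> (\<forall>i. v $ i \<le> \<nu> $ i)))" for V :: "(nat ^ 'n) set"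
  have pick: "pick V \<in> A \<and> (\<forall>v\<in>V. \<not> (\<forall>i. v $ i \<le> pick V $ i))" if "finite V" "V \<subseteq> A" for V
  proof -
    from no that have "\<exists>\<nu>. \<nu> \<in> A \<and> (\<forall>v\<in>V. \<not> (\<forall>i. v $ i \<le> \<nu> $ i))" by metis
    from someI_ex[OF this] show ?thesis unfolding pick_def .
  qed
  \<comment> \<open>The set of the first terms of a sequence in which no term dominates an earlier one.\<close>
  define W where "W = rec_nat {} (\<lambda>_ V. insert (pick V) V)"
  have W: "W 0 = {}" "W (Suc k) = insert (pick (W k)) (W k)" for k by (simp_all add: W_def)
  have fin: "finite (W k) \<and> W k \<subseteq> A" for k
  proof (induction k)
    case (Suc k)
    with pick[of "W k"] show ?case by (simp add: W)
  qed (simp add: W)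
  have mono: "pick (W k) \<in> W l" if "k < l" for k l
    using that by (induction l) (auto simp: W less_Suc_eq)
  obtain \<phi> where \<phi>: "strict_mono \<phi>" "\<forall>i\<in>UNIV. incseq (\<lambda>k. pick (W (\<phi> k)) $ i)"
  proof (rule exE[OF common_subsequence[of UNIV "\<lambda>i \<phi>. incseq (\<lambda>k. pick (W (\<phi> k)) $ i)"]])
    show "incseq (\<lambda>k. pick (W ((\<phi> \<circ> \<psi>) k)) $ i)"
      if "strict_mono \<psi>" "incseq (\<lambda>k. pick (W (\<phi> k)) $ i)" for i and \<phi> \<psi> :: "nat \<Rightarrow> nat"
      using that by (simp add: incseq_def strict_mono_less_eq)
    show "\<exists>\<psi>. strict_mono \<psi> \<and> incseq (\<lambda>k. pick (W ((\<phi> \<circ> \<psi>) k)) $ i)" for i and \<phi> :: "nat \<Rightarrow> nat"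
      using nat_seq_incseq_subsequence[of "\<lambda>k. pick (W (\<phi> k)) $ i"] by (simp add: comp_def)
  qed auto
  have "\<forall>i. pick (W (\<phi> 0)) $ i \<le> pick (W (\<phi> 1)) $ i"
    using \<phi>(2) by (auto simp: incseq_def)
  moreover have "pick (W (\<phi> 0)) \<in> W (\<phi> 1)"
    using \<phi>(1) by (intro mono) (simp add: strict_mono_less)
  ultimately show False using pick[of "W (\<phi> 1)"] fin by blast
qed

section \<open>Power series in several variables\<close>

abbreviation degree :: "nat ^ 'n \<Rightarrow> nat" where
  "degree \<nu> \<equiv> (\<Sum>i\<in>UNIV. \<nu> $ i)"

definition pseries :: "(nat ^ 'n \<Rightarrow> complex) \<Rightarrow> complex ^ 'n \<Rightarrow> complex" where
  "pseries d z = (\<Sum>\<^sub>\<infinity>\<nu>. d \<nu> * monomial \<nu> z)"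

definition converges_at :: "(nat ^ 'n \<Rightarrow> complex) \<Rightarrow> real \<Rightarrow> bool" where
  "converges_at d r \<longleftrightarrow> (\<lambda>\<nu>. norm (d \<nu>) * r ^ degree \<nu>) summable_on UNIV"

lemma norm_monomial: "norm (monomial \<nu> z) = (\<Prod>i\<in>UNIV. norm (z $ i) ^ (\<nu> $ i))"
  by (simp add: monomial_def prod_norm[symmetric] norm_power)

lemma norm_monomial_le:
  assumes "\<And>i. norm (z $ i) \<le> r"
  shows "norm (monomial \<nu> z) \<le> r ^ degree \<nu>"
  unfolding norm_monomial power_sum
  by (intro prod_mono) (use assms in \<open>auto intro: power_mono\<close>)

lemma converges_at_mono:
  assumes "converges_at d r" "0 \<le> s" "s \<le> r"
  shows "converges_at d s"
  unfolding converges_at_def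
  by (rule summable_on_comparison_test[OF assms(1)[unfolded converges_at_def]])
     (use assms in \<open>auto intro: mult_left_mono power_mono\<close>)

lemma pseries_norm_summable:
  assumes "converges_at d r" "\<And>i. norm (z $ i) \<le> r"
  shows "(\<lambda>\<nu>. norm (d \<nu> * monomial \<nu> z)) summable_on A"
proof (rule summable_on_subset_banach)
  show "(\<lambda>\<nu>. norm (d \<nu> * monomial \<nu> z)) summable_on UNIV"
    by (rule summable_on_comparison_test[OF assms(1)[unfolded converges_at_def]])
       (use norm_monomial_le[of z r] assms in \<open>auto simp: norm_mult intro: mult_left_mono\<close>)
qed auto

lemma pseries_summable:
  assumes "converges_at d r" "\<And>i. norm (z $ i) \<le> r"
  shows "(\<lambda>\<nu>. d \<nu> * monomial \<nu> z) summable_on A"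
  using pseries_norm_summable[OF assms] by (rule abs_summable_summable)

text \<open>The Weierstrass test makes the partial sums converge uniformly.\<close>

lemma continuous_on_infsum:
  fixes g :: "'i \<Rightarrow> 'b::topological_space \<Rightarrow> complex"
  assumes "\<And>i. continuous_on K (g i)" "\<And>i z. z \<in> K \<Longrightarrow> norm (g i z) \<le> M i" "M summable_on UNIV"
  shows "continuous_on K (\<lambda>z. \<Sum>\<^sub>\<infinity>i. g i z)"
proof (rule uniform_limit_theorem)
  show "uniform_limit K (\<lambda>X z. \<Sum>i\<in>X. g i z) (\<lambda>z. \<Sum>\<^sub>\<infinity>i. g i z) (finite_subsets_at_top UNIV)"
    by (rule Weierstrass_m_test_general[where M = M]) (use assms in auto)
qed (use assms(1) in \<open>auto intro!: always_eventually continuous_on_sum\<close>)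

lemma continuous_on_monomial [continuous_intros]: "continuous_on K (monomial \<nu>)"
  unfolding monomial_def[abs_def] by (intro continuous_intros)

lemma continuous_on_pseries:
  assumes "converges_at d r"
  shows "continuous_on {z. \<forall>i. norm (z $ i) \<le> r} (pseries d)"
  unfolding pseries_def[abs_def]
proof (rule continuous_on_infsum)
  show "(\<lambda>\<nu>. norm (d \<nu>) * r ^ degree \<nu>) summable_on UNIV"
    using assms by (simp add: converges_at_def)
  show "norm (d \<nu> * monomial \<nu> z) \<le> norm (d \<nu>) * r ^ degree \<nu>"
    if "z \<in> {z. \<forall>i. norm (z $ i) \<le> r}" for \<nu> z
    using that norm_monomial_le[of z r \<nu>] by (auto simp: norm_mult intro: mult_left_mono)
qed (auto intro!: continuous_intros)

lemma monomial_factor: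
  "monomial \<nu> z = z $ j ^ (\<nu> $ j) * (\<Prod>i\<in>UNIV - {j}. z $ i ^ (\<nu> $ i))"
  unfolding monomial_def by (subst prod.remove[of UNIV j]) auto

text \<open>The exponent of \<open>\<partial>\<^sub>j z\<^sup>\<nu>\<close>. The truncated subtraction at \<open>\<nu>\<^sub>j = 0\<close> is harmless, because there the
  coefficient \<open>\<nu>\<^sub>j\<close> of the derivative vanishes.\<close>

definition lower :: "'n \<Rightarrow> nat ^ 'n \<Rightarrow> nat ^ 'n" where
  "lower j \<nu> = (\<chi> i. if i = j then \<nu> $ j - 1 else \<nu> $ i)"

lemma monomial_lower:
  "monomial (lower j \<nu>) z = z $ j ^ (\<nu> $ j - 1) * (\<Prod>i\<in>UNIV - {j}. z $ i ^ (\<nu> $ i))"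
  unfolding monomial_factor[of _ z j] by (auto simp: lower_def intro!: prod.cong)

lemma monomial_lower_mult:
  "z $ j * (of_nat (\<nu> $ j) * monomial (lower j \<nu>) z) = of_nat (\<nu> $ j) * monomial \<nu> z"
  by (cases "\<nu> $ j") (simp_all add: monomial_lower monomial_factor[of \<nu> z j])

lemma degree_lower: "\<nu> $ j > 0 \<Longrightarrow> degree \<nu> = Suc (degree (lower j \<nu>))"
  by (simp add: sum.remove[of UNIV j] lower_def)

text \<open>Halving the radius pays for the factor \<open>\<nu>\<^sub>j\<close>, since \<open>\<nu>\<^sub>j \<le> 2^|\<nu>|\<close>.\<close>

lemma converges_at_mult_exponent:
  assumes "converges_at d r" "0 \<le> r"
  shows "converges_at (\<lambda>\<nu>. d \<nu> * of_nat (\<nu> $ j)) (r / 2)"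
  unfolding converges_at_def
proof (rule summable_on_comparison_test[OF assms(1)[unfolded converges_at_def]])
  fix \<nu> :: "nat ^ 'a"
  have "\<nu> $ j \<le> degree \<nu>" by (rule member_le_sum) auto
  also have "\<dots> < 2 ^ degree \<nu>" by (rule less_exp)
  finally have "real (\<nu> $ j) \<le> 2 ^ degree \<nu>"
    by (metis less_imp_le of_nat_le_iff of_nat_numeral of_nat_power)
  then have "real (\<nu> $ j) * (norm (d \<nu>) * r ^ degree \<nu> / 2 ^ degree \<nu>) \<le>
      2 ^ degree \<nu> * (norm (d \<nu>) * r ^ degree \<nu> / 2 ^ degree \<nu>)"
    using assms(2) by (intro mult_right_mono) auto
  then show "norm (d \<nu> * of_nat (\<nu> $ j)) * (r / 2) ^ degree \<nu> \<le> norm (d \<nu>) * r ^ degree \<nu>"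
    by (simp add: norm_mult power_divide mult_ac)
qed (use assms(2) in auto)

text \<open>A locally uniform limit of holomorphic functions of the single variable \<open>z\<^sub>j\<close> may be differentiated
  termwise. The limit is taken along the filter of finite sets of exponents, so that the
  derivatives of the partial sums converge in the sense of \<open>has_sum\<close>.\<close>

lemma pseries_derivative:
  assumes "converges_at d r" "\<And>i. norm (z $ i) < r"
  shows "((\<lambda>w. pseries d (\<chi> i. if i = j then w else z $ i)) has_field_derivative
           partial (pseries d) j z) (at (z $ j))"
    and "((\<lambda>\<nu>. d \<nu> * of_nat (\<nu> $ j) * monomial (lower j \<nu>) z) has_sum partial (pseries d) j z) UNIV"
proof -
  define L where "L w = (\<chi> i. if i = j then w else z $ i)" for w
  have Lz: "L (z $ j) = z" by (simp add: L_def vec_eq_iff)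
  define e where "e = r - norm (z $ j)"
  have e: "e > 0" using assms(2)[of j] by (simp add: e_def)
  define p where "p \<nu> = (\<Prod>i\<in>UNIV - {j}. z $ i ^ (\<nu> $ i))" for \<nu>
  have mon: "monomial \<nu> (L w) = w ^ (\<nu> $ j) * p \<nu>" for \<nu> w
    unfolding monomial_factor[of \<nu> _ j] by (auto simp: L_def p_def intro!: prod.cong)
  have monl: "monomial (lower j \<nu>) (L w) = w ^ (\<nu> $ j - 1) * p \<nu>" for \<nu> w
    unfolding monomial_lower by (auto simp: L_def p_def intro!: prod.cong)
  have bd: "norm (L w $ i) \<le> r" if "w \<in> cball (z $ j) e" for w i
  proof (cases "i = j")
    case True
    have "norm w \<le> norm (z $ j) + dist (z $ j) w"
      by (metis dist_commute dist_norm norm_triangle_sub)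
    with that True show ?thesis by (auto simp: L_def e_def)
  qed (use assms(2)[of i] in \<open>simp add: L_def\<close>)
  have ul: "uniform_limit (cball (z $ j) e) (\<lambda>X w. \<Sum>\<nu>\<in>X. d \<nu> * monomial \<nu> (L w))
      (\<lambda>w. pseries d (L w)) (finite_subsets_at_top UNIV)"
    unfolding pseries_def
  proof (rule Weierstrass_m_test_general)
    show "(\<lambda>\<nu>. norm (d \<nu>) * r ^ degree \<nu>) summable_on UNIV"
      using assms(1) by (simp add: converges_at_def)
    show "norm (d \<nu> * monomial \<nu> (L w)) \<le> norm (d \<nu>) * r ^ degree \<nu>"
      if "w \<in> cball (z $ j) e" for \<nu> w
      using norm_monomial_le[of "L w" r \<nu>] bd[OF that] by (auto simp: norm_mult intro: mult_left_mono)
  qed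
  have "\<forall>\<^sub>F X in finite_subsets_at_top UNIV.
      continuous_on (cball (z $ j) e) (\<lambda>w. \<Sum>\<nu>\<in>X. d \<nu> * monomial \<nu> (L w)) \<and>
      (\<forall>w\<in>ball (z $ j) e. ((\<lambda>w. \<Sum>\<nu>\<in>X. d \<nu> * monomial \<nu> (L w)) has_field_derivative
          (\<Sum>\<nu>\<in>X. d \<nu> * of_nat (\<nu> $ j) * monomial (lower j \<nu>) (L w))) (at w))"
    unfolding monl unfolding mon
    by (intro always_eventually allI conjI ballI)
       (auto intro!: continuous_intros derivative_eq_intros simp: mult_ac)
  from has_complex_derivative_uniform_limit[OF this ul _ e]
  obtain g' where "\<And>w. w \<in> ball (z $ j) e \<Longrightarrow>
      ((\<lambda>w. pseries d (L w)) has_field_derivative g' w) (at w) \<and>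
      ((\<lambda>X. \<Sum>\<nu>\<in>X. d \<nu> * of_nat (\<nu> $ j) * monomial (lower j \<nu>) (L w)) \<longlongrightarrow> g' w)
        (finite_subsets_at_top UNIV)"
    by auto
  from this[of "z $ j"] e
  have g: "((\<lambda>w. pseries d (L w)) has_field_derivative g' (z $ j)) (at (z $ j))"
    "((\<lambda>X. \<Sum>\<nu>\<in>X. d \<nu> * of_nat (\<nu> $ j) * monomial (lower j \<nu>) z) \<longlongrightarrow> g' (z $ j))
        (finite_subsets_at_top UNIV)"
    by (simp_all add: Lz)
  have p: "partial (pseries d) j z = g' (z $ j)"
    using DERIV_imp_deriv[OF g(1)] by (simp add: partial_def L_def)
  show "((\<lambda>w. pseries d (\<chi> i. if i = j then w else z $ i)) has_field_derivative
           partial (pseries d) j z) (at (z $ j))"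
    using g(1) by (simp add: p L_def)
  show "((\<lambda>\<nu>. d \<nu> * of_nat (\<nu> $ j) * monomial (lower j \<nu>) z) has_sum partial (pseries d) j z) UNIV"
    using g(2) by (simp add: p has_sum_def)
qed

text \<open>The operator \<open>z\<^sub>j \<partial>\<^sub>j\<close> multiplies coefficients and keeps exponents. The generators of \<open>f\<close>
  thus dominate its logarithmic derivatives as well, and the asymptotics of \<open>f\<close> and of its derivatives become instances of the same lemma.\<close>

lemma euler_partial_pseries:
  assumes "converges_at d r" "\<And>i. norm (z $ i) < r"
  shows "z $ j * partial (pseries d) j z = pseries (\<lambda>\<nu>. d \<nu> * of_nat (\<nu> $ j)) z"
proof -
  have "((\<lambda>\<nu>. z $ j * (d \<nu> * of_nat (\<nu> $ j) * monomial (lower j \<nu>) z)) has_sum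
      z $ j * partial (pseries d) j z) UNIV"
    by (rule has_sum_cmult_right[OF pseries_derivative(2)[OF assms]])
  also have "(\<lambda>\<nu>. z $ j * (d \<nu> * of_nat (\<nu> $ j) * monomial (lower j \<nu>) z)) =
      (\<lambda>\<nu>. d \<nu> * of_nat (\<nu> $ j) * monomial \<nu> z)"
    using monomial_lower_mult[of z j] by (auto simp: fun_eq_iff mult_ac)
  finally show ?thesis unfolding pseries_def by (simp add: infsumI)
qed

lemma continuous_on_partial_pseries:
  assumes "converges_at d r" "0 < r"
  shows "continuous_on {z. \<forall>i. norm (z $ i) \<le> r / 2} (partial (pseries d) j)" (is "continuous_on ?K _")
proof -
  let ?e = "\<lambda>\<nu>. d \<nu> * of_nat (\<nu> $ j)"
  have eq: "partial (pseries d) j z = (\<Sum>\<^sub>\<infinity>\<nu>. ?e \<nu> * monomial (lower j \<nu>) z)" if "z \<in> ?K" for z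
  proof -
    have "norm (z $ i) < r" for i
    proof -
      have "norm (z $ i) \<le> r / 2" using that by simp
      with assms(2) show ?thesis by linarith
    qed
    from infsumI[OF pseries_derivative(2)[OF assms(1) this]] show ?thesis by simp
  qed
  have "continuous_on ?K (\<lambda>z. \<Sum>\<^sub>\<infinity>\<nu>. ?e \<nu> * monomial (lower j \<nu>) z)"
  proof (rule continuous_on_infsum)
    show "(\<lambda>\<nu>. norm (?e \<nu>) * (r / 2) ^ degree \<nu> * (2 / r)) summable_on UNIV"
      using converges_at_mult_exponent[OF assms(1), of j] assms(2)
      by (intro summable_on_cmult_left) (simp add: converges_at_def)
    fix \<nu> z assume z: "z \<in> ?K"
    show "norm (?e \<nu> * monomial (lower j \<nu>) z) \<le> norm (?e \<nu>) * (r / 2) ^ degree \<nu> * (2 / r)"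
    proof (cases "\<nu> $ j = 0")
      case False
      then have "(r / 2) ^ degree \<nu> * (2 / r) = (r / 2) ^ degree (lower j \<nu>)"
        using assms(2) by (simp add: degree_lower[of \<nu> j] field_simps)
      moreover have "norm (monomial (lower j \<nu>) z) \<le> (r / 2) ^ degree (lower j \<nu>)"
        using z by (intro norm_monomial_le) auto
      ultimately show ?thesis
        by (metis (no_types, lifting) mult.assoc mult_left_mono norm_ge_zero norm_mult)
    qed simp
  qed (auto intro!: continuous_intros)
  then show ?thesis by (subst continuous_on_cong[OF refl eq]) auto
qed

section \<open>Vertices of polyhedra\<close>

text \<open>A polyhedron \<open>{Q. b \<le> a \<bullet> Q}\<close> without lines, on which \<open>e\<close> is bounded below, has a vertex at which \<open>e\<close>
  is no larger than at a given point and at which the constraints active there stay active. Among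
  these competitors one with most active constraints is such a vertex: if its active constraints did not span, one could
  move along a direction orthogonal to all of them, not increasing \<open>e\<close>, until another one becomes active.\<close>

lemma polyhedron_vertex_below:
  fixes A :: "('a::euclidean_space \<times> real) set" and Q0 e :: 'a
  assumes fin: "finite A"
    and feas: "\<And>a b. (a, b) \<in> A \<Longrightarrow> b \<le> a \<bullet> Q0"
    and pointed: "\<And>D. (\<And>a b. (a, b) \<in> A \<Longrightarrow> a \<bullet> D = 0) \<Longrightarrow> D = 0"
    and bounded: "\<And>D. (\<And>a b. (a, b) \<in> A \<Longrightarrow> 0 \<le> a \<bullet> D) \<Longrightarrow> 0 \<le> e \<bullet> D"
  shows "\<exists>Q. (\<forall>a b. (a, b) \<in> A \<longrightarrow> b \<le> a \<bullet> Q) \<and> e \<bullet> Q \<le> e \<bullet> Q0 \<and>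
    (\<forall>a b. (a, b) \<in> A \<and> a \<bullet> Q0 = b \<longrightarrow> a \<bullet> Q = b) \<and>
    span {a. \<exists>b. (a, b) \<in> A \<and> a \<bullet> Q = b} = UNIV"
proof -
  define act where "act Q = {ab \<in> A. fst ab \<bullet> Q = snd ab}" for Q
  define good where "good Q \<longleftrightarrow> (\<forall>ab\<in>A. snd ab \<le> fst ab \<bullet> Q) \<and> e \<bullet> Q \<le> e \<bullet> Q0 \<and> act Q0 \<subseteq> act Q" for Q
  have "good Q0" using feas by (auto simp: good_def)
  moreover have "card (act Q) < Suc (card A)" for Q
    unfolding act_def using fin by (simp add: card_mono le_imp_less_Suc)
  ultimately obtain Q where Q: "good Q" and max: "\<And>R. good R \<Longrightarrow> card (act R) \<le> card (act Q)"
    using ex_has_greatest_nat[of good Q0 "\<lambda>Q. card (act Q)"] by metis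
  have "span (fst ` act Q) = UNIV"
  proof (rule ccontr)
    assume "span (fst ` act Q) \<noteq> UNIV"
    then obtain D where D: "D \<noteq> 0" "\<And>a. a \<in> span (fst ` act Q) \<Longrightarrow> D \<bullet> a = 0"
      using span_not_UNIV_orthogonal by blast
    have D0: "fst ab \<bullet> D = 0" if "ab \<in> act Q" for ab
      using D(2)[of "fst ab"] that by (auto simp: inner_commute intro: span_base)
    \<comment> \<open>One of the two directions \<open>D\<close> and \<open>-D\<close> does not increase \<open>e\<close> and leaves the polyhedron.\<close>
    have "\<exists>D. (\<forall>ab\<in>act Q. fst ab \<bullet> D = 0) \<and> e \<bullet> D \<le> 0 \<and> (\<exists>ab\<in>A. fst ab \<bullet> D < 0)"
    proof (cases "e \<bullet> D = 0")
      case True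
      obtain a b where ab: "(a, b) \<in> A" "a \<bullet> D \<noteq> 0" using pointed D(1) by blast
      show ?thesis
      proof (cases "a \<bullet> D < 0")
        case True
        with ab \<open>e \<bullet> D = 0\<close> D0 show ?thesis by (intro exI[of _ D]) force
      next
        case False
        with ab \<open>e \<bullet> D = 0\<close> D0 show ?thesis by (intro exI[of _ "- D"]) force
      qed
    next
      case False
      define E where "E = (if e \<bullet> D < 0 then D else - D)"
      have E: "e \<bullet> E < 0" "\<forall>ab\<in>act Q. fst ab \<bullet> E = 0" using False D0 by (auto simp: E_def)
      with bounded[of E] have "\<exists>ab\<in>A. fst ab \<bullet> E < 0" by force
      with E show ?thesis by force
    qed
    then obtain D where D0: "\<And>ab. ab \<in> act Q \<Longrightarrow> fst ab \<bullet> D = 0" and De: "e \<bullet> D \<le> 0"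
      and ex: "\<exists>ab\<in>A. fst ab \<bullet> D < 0" by blast
    \<comment> \<open>Follow it until a further inequality becomes an equality.\<close>
    define B where "B = {ab \<in> A. fst ab \<bullet> D < 0}"
    define \<tau> where "\<tau> ab = (fst ab \<bullet> Q - snd ab) / - (fst ab \<bullet> D)" for ab
    define t where "t = Min (\<tau> ` B)"
    have B: "finite B" "B \<noteq> {}" using fin ex by (auto simp: B_def)
    then have "t \<in> \<tau> ` B" unfolding t_def by (intro Min_in) auto
    then obtain ab0 where ab0: "ab0 \<in> B" "\<tau> ab0 = t" by blast
    have tle: "t \<le> \<tau> ab" if "ab \<in> B" for ab using B that by (simp add: t_def)
    have slack: "snd ab \<le> fst ab \<bullet> Q" if "ab \<in> A" for ab using Q that by (auto simp: good_def)
    have t0: "0 \<le> t"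
      unfolding ab0(2)[symmetric] \<tau>_def using ab0(1) slack[of ab0]
      by (intro divide_nonneg_nonneg) (auto simp: B_def)
    define R where "R = Q + t *\<^sub>R D"
    have in_R: "fst ab \<bullet> R = fst ab \<bullet> Q + t * (fst ab \<bullet> D)" for ab
      by (simp add: R_def inner_add_right)
    have "snd ab \<le> fst ab \<bullet> R" if "ab \<in> A" for ab
    proof (cases "ab \<in> B")
      case True
      with tle[OF True] show ?thesis unfolding in_R by (auto simp: \<tau>_def B_def field_simps)
    next
      case False
      with that t0 slack[OF that] show ?thesis unfolding in_R by (auto simp: B_def intro: add_increasing2)
    qed
    moreover have "e \<bullet> R \<le> e \<bullet> Q0"
      using Q De t0 by (auto simp: R_def good_def inner_add_right mult_nonneg_nonpos intro: add_decreasing2)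
    moreover have sub: "act Q \<subseteq> act R" using D0 by (auto simp: act_def in_R)
    moreover have "act Q0 \<subseteq> act Q" using Q by (simp add: good_def)
    ultimately have "good R" by (auto simp: good_def)
    have "ab0 \<in> act R - act Q"
      using ab0 D0[of ab0] by (auto simp: B_def act_def in_R \<tau>_def field_simps)
    then have "act Q \<subset> act R" using sub by blast
    moreover have "finite (act R)" using fin by (simp add: act_def)
    ultimately have "card (act Q) < card (act R)" by (simp add: psubset_card_mono)
    with max[OF \<open>good R\<close>] show False by simp
  qed
  moreover have "fst ` act Q = {a. \<exists>b. (a, b) \<in> A \<and> a \<bullet> Q = b}" by (force simp: act_def)
  moreover have "a \<bullet> Q = b" if "(a, b) \<in> A" "a \<bullet> Q0 = b" for a b
    using Q that unfolding good_def act_def by force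
  ultimately show ?thesis using Q by (intro exI[of _ Q]) (auto simp: good_def)
qed

text \<open>On a hyperplane that misses the origin, passing from the affine hull to the linear span adds one
  dimension. This turns the dimension condition on facets into a spanning condition.\<close>

lemma aff_dim_hyperplane_iff_span:
  fixes S :: "'a::euclidean_space set"
  assumes "\<And>x. x \<in> S \<Longrightarrow> Q \<bullet> x = 1"
  shows "aff_dim S = int DIM('a) - 1 \<longleftrightarrow> span S = UNIV"
proof -
  have "affine hull S \<subseteq> {x. Q \<bullet> x = 1}"
    by (rule hull_minimal) (use assms in \<open>auto simp: affine_hyperplane\<close>)
  then have "0 \<notin> affine hull S" by auto
  then have "aff_dim (insert 0 S) = aff_dim S + 1" by (simp add: aff_dim_insert)
  moreover have "aff_dim (insert 0 S) = int (dim (insert 0 S))"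
    by (rule aff_dim_zero) (simp add: hull_inc)
  moreover have "dim (insert 0 S) = dim S" by (metis dim_span span_insert_0)
  ultimately have "aff_dim S = int DIM('a) - 1 \<longleftrightarrow> dim S = DIM('a)" by linarith
  then show ?thesis by (simp add: dim_eq_full)
qed

section \<open>The Newton polyhedron\<close>

lemma inner_real_exponent: "P \<bullet> real_exponent \<nu> = (\<Sum>i\<in>UNIV. P $ i * real (\<nu> $ i))"
  by (simp add: inner_vec_def real_exponent_def)

lemma real_exponent_eq_iff [simp]: "real_exponent \<nu> = real_exponent \<mu> \<longleftrightarrow> \<nu> = \<mu>"
  by (auto simp: real_exponent_def vec_eq_iff)

text \<open>Finitely many exponents of the series that generate the Newton polyhedron. They exist by Dickson's
  lemma, and all statements about faces reduce to them.\<close>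

locale exponent_generators =
  fixes c :: "nat ^ 'n \<Rightarrow> complex" and V :: "(nat ^ 'n) set"
  assumes finite_V: "finite V"
    and V_nonempty: "V \<noteq> {}"
    and V_support: "v \<in> V \<Longrightarrow> c v \<noteq> 0"
    and V_dominates: "c \<nu> \<noteq> 0 \<Longrightarrow> \<exists>v\<in>V. \<forall>i. v $ i \<le> \<nu> $ i"
begin

text \<open>The Newton polyhedron is the convex hull of \<open>V\<close> plus the nonnegative orthant: sums of this form are
  a convex set, and every exponent exceeds some element of \<open>V\<close>.\<close>

lemma newton_polyhedron_decompose:
  assumes "x \<in> newton_polyhedron c"
  shows "\<exists>\<kappa> y. (\<forall>v\<in>V. 0 \<le> \<kappa> v) \<and> sum \<kappa> V = 1 \<and> (\<forall>i. 0 \<le> y $ i) \<and>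
    x = (\<Sum>v\<in>V. \<kappa> v *\<^sub>R real_exponent v) + y"
proof -
  define T where "T = {(\<Sum>v\<in>V. \<kappa> v *\<^sub>R real_exponent v) + y | \<kappa> y.
    (\<forall>v\<in>V. 0 \<le> \<kappa> v) \<and> sum \<kappa> V = 1 \<and> (\<forall>i. 0 \<le> y $ i)}"
  have "convex T"
  proof (rule convexI)
    fix x1 x2 :: "real ^ 'n" and s t :: real
    assume "x1 \<in> T" "x2 \<in> T" and st: "0 \<le> s" "0 \<le> t" "s + t = 1"
    then obtain \<kappa>1 y1 \<kappa>2 y2 where
      1: "x1 = (\<Sum>v\<in>V. \<kappa>1 v *\<^sub>R real_exponent v) + y1" "\<forall>v\<in>V. 0 \<le> \<kappa>1 v" "sum \<kappa>1 V = 1" "\<forall>i. 0 \<le> y1 $ i"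
      and 2: "x2 = (\<Sum>v\<in>V. \<kappa>2 v *\<^sub>R real_exponent v) + y2" "\<forall>v\<in>V. 0 \<le> \<kappa>2 v" "sum \<kappa>2 V = 1" "\<forall>i. 0 \<le> y2 $ i"
      unfolding T_def by blast
    have "s *\<^sub>R x1 + t *\<^sub>R x2 = (\<Sum>v\<in>V. (s * \<kappa>1 v + t * \<kappa>2 v) *\<^sub>R real_exponent v) + (s *\<^sub>R y1 + t *\<^sub>R y2)"
      by (simp add: 1 2 scaleR_add_right scaleR_add_left sum.distrib scaleR_sum_right)
    moreover have "(\<Sum>v\<in>V. s * \<kappa>1 v + t * \<kappa>2 v) = 1"
      using 1 2 st by (simp add: sum.distrib sum_distrib_left[symmetric])
    ultimately show "s *\<^sub>R x1 + t *\<^sub>R x2 \<in> T"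
      unfolding T_def using 1 2 st
      by (intro CollectI exI[of _ "\<lambda>v. s * \<kappa>1 v + t * \<kappa>2 v"] exI[of _ "s *\<^sub>R y1 + t *\<^sub>R y2"]) auto
  qed
  moreover have "real_exponent \<nu> + y \<in> T" if \<nu>: "c \<nu> \<noteq> 0" "\<forall>i. 0 \<le> y $ i" for \<nu> and y :: "real ^ 'n"
  proof -
    obtain v where v: "v \<in> V" "\<forall>i. v $ i \<le> \<nu> $ i" using V_dominates \<nu> by blast
    have "(\<Sum>w\<in>V. (if w = v then 1 else 0) *\<^sub>R real_exponent w) = real_exponent v"
      using finite_V v(1) by (simp add: if_distrib[of "\<lambda>x. x *\<^sub>R _"] cong: if_cong)
    then show ?thesis
      unfolding T_def using finite_V v \<nu>
      by (intro CollectI exI[of _ "\<lambda>w. if w = v then 1 else 0"]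
          exI[of _ "real_exponent \<nu> - real_exponent v + y"]) (auto simp: real_exponent_def)
  qed
  ultimately have "newton_polyhedron c \<subseteq> T"
    unfolding newton_polyhedron_def by (intro hull_minimal) auto
  with assms show ?thesis unfolding T_def by blast
qed

lemma real_exponent_add_in_newton:
  "c \<nu> \<noteq> 0 \<Longrightarrow> (\<And>i. 0 \<le> y $ i) \<Longrightarrow> real_exponent \<nu> + y \<in> newton_polyhedron c"
  unfolding newton_polyhedron_def by (rule hull_inc) blast

lemma real_exponent_in_newton: "c \<nu> \<noteq> 0 \<Longrightarrow> real_exponent \<nu> \<in> newton_polyhedron c"
  using real_exponent_add_in_newton[of \<nu> 0] by simp

text \<open>The excess of \<open>P\<close> over a level \<open>m\<close>, split into the contributions of the generators and of the orthant. With
  \<open>m = min_weight c P\<close> all contributions are nonnegative, so on the face each of them vanishes.\<close>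

lemma newton_excess:
  assumes "sum \<kappa> V = 1"
  shows "P \<bullet> ((\<Sum>v\<in>V. \<kappa> v *\<^sub>R real_exponent v) + y) - m =
    (\<Sum>v\<in>V. \<kappa> v * (P \<bullet> real_exponent v - m)) + (\<Sum>i\<in>UNIV. P $ i * y $ i)"
proof -
  have "(\<Sum>v\<in>V. \<kappa> v * (P \<bullet> real_exponent v - m)) = (\<Sum>v\<in>V. \<kappa> v * (P \<bullet> real_exponent v)) - sum \<kappa> V * m"
    by (simp add: right_diff_distrib sum_subtractf sum_distrib_right)
  moreover have "P \<bullet> y = (\<Sum>i\<in>UNIV. P $ i * y $ i)" by (simp add: inner_vec_def)
  ultimately show ?thesis using assms by (simp add: inner_add_right inner_sum_right)
qed

lemma min_weight_Min:
  assumes "P \<in> weights"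
  shows "min_weight c P = Min ((\<lambda>v. P \<bullet> real_exponent v) ` V)"
proof -
  let ?m = "Min ((\<lambda>v. P \<bullet> real_exponent v) ` V)"
  have "?m \<in> (\<bullet>) P ` newton_polyhedron c"
  proof -
    have "?m \<in> (\<lambda>v. P \<bullet> real_exponent v) ` V" by (intro Min_in) (use finite_V V_nonempty in auto)
    then show ?thesis using V_support real_exponent_in_newton by blast
  qed
  moreover have "?m \<le> P \<bullet> x" if "x \<in> newton_polyhedron c" for x
  proof -
    from newton_polyhedron_decompose[OF that] obtain \<kappa> y where
      *: "\<forall>v\<in>V. 0 \<le> \<kappa> v" "sum \<kappa> V = 1" "\<forall>i. 0 \<le> y $ i"
      "x = (\<Sum>v\<in>V. \<kappa> v *\<^sub>R real_exponent v) + y" by blast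
    have "0 \<le> P \<bullet> x - ?m"
      unfolding *(4) newton_excess[OF *(2)]
      using * assms finite_V
      by (intro add_nonneg_nonneg sum_nonneg mult_nonneg_nonneg) (auto simp: weights_def)
    then show ?thesis by simp
  qed
  ultimately show ?thesis unfolding min_weight_def by (intro cInf_eq_minimum) auto
qed

lemma min_weight_le_V: "P \<in> weights \<Longrightarrow> v \<in> V \<Longrightarrow> min_weight c P \<le> P \<bullet> real_exponent v"
  using finite_V by (simp add: min_weight_Min)

lemma min_weight_attained:
  assumes "P \<in> weights"
  obtains v where "v \<in> V" "P \<bullet> real_exponent v = min_weight c P"
proof -
  have "min_weight c P \<in> (\<lambda>v. P \<bullet> real_exponent v) ` V"
    unfolding min_weight_Min[OF assms] by (intro Min_in) (use finite_V V_nonempty in auto)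
  then obtain v where "v \<in> V" "min_weight c P = P \<bullet> real_exponent v" by blast
  then show thesis by (intro that[of v]) auto
qed

lemma real_exponent_in_face_iff:
  "c \<nu> \<noteq> 0 \<Longrightarrow> real_exponent \<nu> \<in> face c P \<longleftrightarrow> P \<bullet> real_exponent \<nu> = min_weight c P"
  by (simp add: face_def real_exponent_in_newton)

lemma face_decompose:
  assumes "P \<in> weights" and x: "x \<in> face c P"
  shows "\<exists>\<kappa> y. sum \<kappa> V = 1 \<and> x = (\<Sum>v\<in>V. \<kappa> v *\<^sub>R real_exponent v) + y \<and>
    (\<forall>v\<in>V. \<kappa> v = 0 \<or> P \<bullet> real_exponent v = min_weight c P) \<and> (\<forall>i. P $ i = 0 \<or> y $ i = 0)"
proof -
  from x have "x \<in> newton_polyhedron c" by (simp add: face_def)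
  from newton_polyhedron_decompose[OF this] obtain \<kappa> y where
    *: "\<forall>v\<in>V. 0 \<le> \<kappa> v" "sum \<kappa> V = 1" "\<forall>i. 0 \<le> y $ i"
      "x = (\<Sum>v\<in>V. \<kappa> v *\<^sub>R real_exponent v) + y" by blast
  let ?p = "\<lambda>v. \<kappa> v * (P \<bullet> real_exponent v - min_weight c P)"
  have p: "0 \<le> ?p v" if "v \<in> V" for v using *(1) that min_weight_le_V[OF assms(1) that] by simp
  have y: "0 \<le> P $ i * y $ i" for i using *(3) assms(1) by (simp add: weights_def)
  have "sum ?p V + (\<Sum>i\<in>UNIV. P $ i * y $ i) = 0"
    using x unfolding newton_excess[OF *(2), symmetric] *(4)[symmetric] by (simp add: face_def)
  moreover have "0 \<le> sum ?p V" "0 \<le> (\<Sum>i\<in>UNIV. P $ i * y $ i)" using p y by (auto intro: sum_nonneg)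
  ultimately have "sum ?p V = 0" "(\<Sum>i\<in>UNIV. P $ i * y $ i) = 0" by linarith+
  then have "\<forall>v\<in>V. ?p v = 0" "\<forall>i. P $ i * y $ i = 0"
    using p y finite_V by (simp_all add: sum_nonneg_eq_0_iff)
  with * show ?thesis by (intro exI[of _ \<kappa>] exI[of _ y]) auto
qed

text \<open>A face is determined by the generators on it and by the coordinate directions along which it is
  unbounded.\<close>

lemma face_subset:
  assumes "P \<in> weights"
    and V: "\<And>v. v \<in> V \<Longrightarrow> P \<bullet> real_exponent v = min_weight c P \<Longrightarrow> Q \<bullet> real_exponent v = min_weight c Q"
    and I: "\<And>i. P $ i = 0 \<Longrightarrow> Q $ i = 0"
  shows "face c P \<subseteq> face c Q"
proof
  fix x assume x: "x \<in> face c P"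
  from face_decompose[OF assms(1) x] obtain \<kappa> y where *: "sum \<kappa> V = 1"
    "x = (\<Sum>v\<in>V. \<kappa> v *\<^sub>R real_exponent v) + y"
    "\<forall>v\<in>V. \<kappa> v = 0 \<or> P \<bullet> real_exponent v = min_weight c P" "\<forall>i. P $ i = 0 \<or> y $ i = 0" by blast
  have "\<kappa> v * (Q \<bullet> real_exponent v - min_weight c Q) = 0" if "v \<in> V" for v
    using *(3) that V[OF that] by auto
  moreover have "Q $ i * y $ i = 0" for i using *(4) I[of i] by auto
  ultimately have "Q \<bullet> x - min_weight c Q = 0"
    unfolding *(2) newton_excess[OF *(1)] by (simp only: sum.neutral_const cong: sum.cong)
  with x show "x \<in> face c Q" by (simp add: face_def)
qed

lemma face_nonempty: "P \<in> weights \<Longrightarrow> face c P \<noteq> {}"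
  by (metis V_support empty_iff min_weight_attained real_exponent_in_face_iff)

section \<open>Facets\<close>

lemma normalized_face:
  assumes "min_weight c P > 0"
  shows "x \<in> face c P \<Longrightarrow> normalized c P \<bullet> x = 1"
    and "P \<bullet> x = min_weight c P \<longleftrightarrow> normalized c P \<bullet> x = 1"
  using assms by (auto simp: face_def normalized_def field_simps)

text \<open>The generators on a facet and its unbounded directions determine the facet, and the normalised weight is the only
  linear form equal to 1 on it.\<close>

lemma finite_normalized_facets:
  "finite {normalized c P | P. P \<in> weights \<and> min_weight c P > 0 \<and> aff_dim (face c P) = int CARD('n) - 1}"
    (is "finite ?N")
proof (rule finite_imageD)
  \<comment> \<open>The combinatorial data that determine a normalised facet weight; there are finitely many.\<close>
  define key where "key Q = ({v\<in>V. Q \<bullet> real_exponent v = 1}, {i. Q $ i = 0})" for Q :: "real ^ 'n"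
  have "key ` ?N \<subseteq> Pow V \<times> UNIV" by (auto simp: key_def)
  then show "finite (key ` ?N)" by (rule finite_subset) (simp add: finite_V)
  show "inj_on key ?N"
  proof (rule inj_onI)
    fix Q R assume "Q \<in> ?N" "R \<in> ?N" and k: "key Q = key R"
    then obtain P P' where P: "Q = normalized c P" "P \<in> weights" "min_weight c P > 0" "aff_dim (face c P) = int CARD('n) - 1"
      and P': "R = normalized c P'" "P' \<in> weights" "min_weight c P' > 0" by blast
    have "{v\<in>V. Q \<bullet> real_exponent v = 1} = {v\<in>V. R \<bullet> real_exponent v = 1}" "{i. Q $ i = 0} = {i. R $ i = 0}"
      using k by (simp_all add: key_def)
    moreover have "Q $ i = 0 \<longleftrightarrow> P $ i = 0" "R $ i = 0 \<longleftrightarrow> P' $ i = 0" for i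
      using P P' by (simp_all add: normalized_def)
    ultimately have "face c P \<subseteq> face c P'"
      using normalized_face(2)[OF P(3)] normalized_face(2)[OF P'(3)] P(1) P'(1)
      by (intro face_subset P) blast+
    then have R: "R \<bullet> x = 1" and Q: "Q \<bullet> x = 1" if "x \<in> face c P" for x
      using that normalized_face(1)[OF P(3)] normalized_face(1)[OF P'(3)] P(1) P'(1) by auto
    have "span (face c P) = UNIV"
      using aff_dim_hyperplane_iff_span[of "face c P" Q] Q P(4) by simp
    moreover have "(Q - R) \<bullet> x = 0" if "x \<in> span (face c P)" for x
      using that by (induction rule: span_induct)
        (auto simp: subspace_def inner_add_right inner_diff_left Q R algebra_simps)
    ultimately have "(Q - R) \<bullet> (Q - R) = 0" by blast
    then show "Q = R" by simp
  qed
qed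

text \<open>The normalised weights form the polyhedron \<open>{Q. 0 \<le> Q\<^sub>i, 1 \<le> Q \<bullet> v for v \<in> V}\<close>, and a vertex of it is a facet
  weight: the active constraints span, an active \<open>v\<close> lies on the face of \<open>Q\<close>, and an active \<open>Q\<^sub>i = 0\<close>
  means that the face is unbounded in direction \<open>i\<close>.\<close>

lemma facet_below_weight:
  assumes P: "P \<in> weights" "min_weight c P > 0"
  obtains Q where "Q \<in> weights" "min_weight c Q = 1" "aff_dim (face c Q) = int CARD('n) - 1"
    "\<And>v. v \<in> V \<Longrightarrow> P \<bullet> real_exponent v = min_weight c P \<Longrightarrow> Q \<bullet> real_exponent v = 1"
    "Q $ j \<le> normalized c P $ j"
proof -
  define A where "A = (\<lambda>v. (real_exponent v, 1::real)) ` V \<union> range (\<lambda>i. (axis i 1 :: real ^ 'n, 0::real))"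
  have finA: "finite A" using finite_V by (simp add: A_def)
  have feas: "b \<le> a \<bullet> normalized c P" if "(a, b) \<in> A" for a b
    using that P min_weight_le_V[OF P(1)]
    by (auto simp: A_def normalized_def inner_axis' weights_def inner_commute[of "real_exponent _"] field_simps)
  have pointed: "D = 0" if "\<And>a b. (a, b) \<in> A \<Longrightarrow> a \<bullet> D = 0" for D
  proof -
    have "D $ i = 0" for i using that[of "axis i 1" 0] by (auto simp: A_def inner_axis')
    then show ?thesis by (simp add: vec_eq_iff)
  qed
  have bounded: "0 \<le> axis j 1 \<bullet> D" if "\<And>a b. (a, b) \<in> A \<Longrightarrow> 0 \<le> a \<bullet> D" for D
    using that[of "axis j 1" 0] by (auto simp: A_def)
  from polyhedron_vertex_below[OF finA feas pointed bounded]
  obtain Q where "\<forall>a b. (a, b) \<in> A \<longrightarrow> b \<le> a \<bullet> Q"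
    and Q2: "axis j 1 \<bullet> Q \<le> axis j 1 \<bullet> normalized c P"
    and "\<forall>a b. (a, b) \<in> A \<and> a \<bullet> normalized c P = b \<longrightarrow> a \<bullet> Q = b"
    and Q4: "span {a. \<exists>b. (a, b) \<in> A \<and> a \<bullet> Q = b} = UNIV" by blast
  then have Q1: "\<And>a b. (a, b) \<in> A \<Longrightarrow> b \<le> a \<bullet> Q"
    and Q3: "\<And>a b. (a, b) \<in> A \<Longrightarrow> a \<bullet> normalized c P = b \<Longrightarrow> a \<bullet> Q = b" by blast+
  have QV: "1 \<le> Q \<bullet> real_exponent v" if "v \<in> V" for v
    using Q1[of "real_exponent v" 1] that by (auto simp: A_def inner_commute)
  have Q0: "0 \<le> Q $ i" for i using Q1[of "axis i 1" 0] by (auto simp: A_def inner_axis')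
  then have W: "Q \<in> weights" by (simp add: weights_def)
  have act: "Q \<bullet> real_exponent v = 1" if "v \<in> V" "P \<bullet> real_exponent v = min_weight c P" for v
    using Q3[of "real_exponent v" 1] that normalized_face(2)[OF P(2)] by (auto simp: A_def inner_commute)
  obtain v0 where v0: "v0 \<in> V" "Q \<bullet> real_exponent v0 = 1"
    using min_weight_attained[OF P(1)] act by metis
  obtain v1 where v1: "v1 \<in> V" "Q \<bullet> real_exponent v1 = min_weight c Q"
    using min_weight_attained[OF W] by metis
  have m: "min_weight c Q = 1" using QV[OF v1(1)] v1(2) min_weight_le_V[OF W v0(1)] v0(2) by linarith
  have "{a. \<exists>b. (a, b) \<in> A \<and> a \<bullet> Q = b} \<subseteq> span (face c Q)"
  proof (clarify)
    fix a assume "(a, a \<bullet> Q) \<in> A"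
    then consider v where "v \<in> V" "a = real_exponent v" "a \<bullet> Q = 1" | i where "a = axis i 1" "a \<bullet> Q = 0"
      by (auto simp: A_def)
    then show "a \<in> span (face c Q)"
    proof cases
      case 1
      with m V_support show ?thesis by (intro span_base) (simp add: real_exponent_in_face_iff inner_commute)
    next
      case 2
      have "real_exponent v0 \<in> face c Q" using v0 m V_support by (simp add: real_exponent_in_face_iff)
      moreover have "real_exponent v0 + axis i 1 \<in> face c Q"
        using v0 m 2 V_support
        by (auto simp: face_def inner_add_right inner_commute axis_def intro!: real_exponent_add_in_newton)
      ultimately have "(real_exponent v0 + axis i 1) - real_exponent v0 \<in> span (face c Q)"
        by (intro span_diff span_base)
      with 2 show ?thesis by simp
    qed
  qed
  then have "span (face c Q) = UNIV" using Q4 span_minimal subspace_span by blast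
  then have "aff_dim (face c Q) = int CARD('n) - 1"
    using aff_dim_hyperplane_iff_span[of "face c Q" Q] m by (simp add: face_def)
  moreover have "Q $ j \<le> normalized c P $ j" using Q2 by (simp add: inner_axis')
  ultimately show thesis using that W m act by blast
qed

end

section \<open>Initial forms\<close>

text \<open>Every term outside \<open>S\<close> is dominated by a generator \<open>v\<close>: either \<open>v \<notin> S\<close>, or \<open>v \<in> S\<close> and the term has at
  least one more factor \<open>z\<^sub>i\<close>, which gains \<open>t / r\<close>. Summing the absolute values of the coefficients
  leaves one explicit bound for the whole tail.\<close>

lemma pseries_remainder_bound:
  assumes "finite V" "S \<subseteq> V"
    and dom: "\<And>\<nu>. d \<nu> \<noteq> 0 \<Longrightarrow> \<exists>v\<in>V. \<forall>i. v $ i \<le> \<nu> $ i"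
    and conv: "converges_at d r" and t: "0 < r" "0 \<le> t" "t \<le> r"
    and z: "\<And>i. norm (z $ i) \<le> t"
  shows "norm (pseries d z - (\<Sum>\<nu>\<in>S. d \<nu> * monomial \<nu> z)) \<le>
    (\<Sum>\<^sub>\<infinity>\<nu>. norm (d \<nu>) * r ^ degree \<nu>) *
    (\<Sum>v\<in>V. norm (monomial v z) / r ^ degree v * (if v \<in> S then t / r else 1))"
proof -
  define G where "G v = norm (monomial v z) / r ^ degree v * (if v \<in> S then t / r else 1)" for v
  have G0: "0 \<le> G v" for v using t by (simp add: G_def)
  have zr: "norm (z $ i) \<le> r" for i using z[of i] t by linarith
  have finS: "finite S" using assms(1,2) finite_subset by blast
  have term_bound: "norm (d \<nu> * monomial \<nu> z) \<le> norm (d \<nu>) * r ^ degree \<nu> * sum G V" if "\<nu> \<notin> S" for \<nu>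
  proof (cases "d \<nu> = 0")
    case False
    then obtain v where v: "v \<in> V" "\<And>i. v $ i \<le> \<nu> $ i" using dom by blast
    define e where "e = (\<chi> i. \<nu> $ i - v $ i)"
    have \<nu>: "\<nu> $ i = v $ i + e $ i" for i using v(2)[of i] by (simp add: e_def)
    have deg: "degree \<nu> = degree v + degree e" by (simp add: \<nu> sum.distrib)
    have mon: "monomial \<nu> z = monomial v z * monomial e z"
      by (simp add: monomial_def \<nu> power_add prod.distrib)
    have "norm (monomial e z) \<le> t ^ degree e" by (rule norm_monomial_le) (rule z)
    also have "t ^ degree e \<le> r ^ degree e * (if v \<in> S then t / r else 1)"
    proof (cases "v \<in> S")
      case True
      with that have "v \<noteq> \<nu>" by blast
      then obtain i where "e $ i \<noteq> 0" using \<nu> by (auto simp: vec_eq_iff)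
      then have "degree e \<noteq> 0" by auto
      then obtain m where m: "degree e = Suc m" by (cases "degree e") auto
      have "t ^ m * t \<le> r ^ m * t" using t by (intro mult_right_mono power_mono) auto
      with True t show ?thesis by (simp add: m field_simps)
    qed (use t in \<open>auto intro: power_mono\<close>)
    finally have e: "norm (monomial e z) \<le> r ^ degree e * (if v \<in> S then t / r else 1)" .
    have "norm (monomial \<nu> z) \<le> norm (monomial v z) * (r ^ degree e * (if v \<in> S then t / r else 1))"
      unfolding mon norm_mult by (intro mult_left_mono e) auto
    also have "\<dots> = r ^ degree \<nu> * G v"
      using t by (simp add: G_def deg power_add)
    also have "\<dots> \<le> r ^ degree \<nu> * sum G V"
      using t v(1) G0 assms(1) by (intro mult_left_mono member_le_sum) auto
    finally show ?thesis unfolding norm_mult mult.assoc by (intro mult_left_mono) auto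
  qed simp
  let ?T = "\<lambda>\<nu>. d \<nu> * monomial \<nu> z"
  have sm: "?T summable_on A" for A by (rule pseries_summable[OF conv zr])
  have "pseries d z - sum ?T S = infsum ?T (UNIV - S)"
    unfolding pseries_def using finS by (subst infsum_Diff[OF sm sm]) auto
  also have "norm \<dots> \<le> infsum (\<lambda>\<nu>. norm (?T \<nu>)) (UNIV - S)"
    by (rule norm_infsum_bound) (rule pseries_norm_summable[OF conv zr])
  also have "\<dots> \<le> infsum (\<lambda>\<nu>. norm (d \<nu>) * r ^ degree \<nu> * sum G V) UNIV"
  proof (rule infsum_mono_neutral)
    show "(\<lambda>\<nu>. norm (?T \<nu>)) summable_on UNIV - S" by (rule pseries_norm_summable[OF conv zr])
    show "(\<lambda>\<nu>. norm (d \<nu>) * r ^ degree \<nu> * sum G V) summable_on UNIV"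
      using conv by (intro summable_on_cmult_left) (simp add: converges_at_def)
    show "0 \<le> norm (d \<nu>) * r ^ degree \<nu> * sum G V" for \<nu>
      using t G0 by (intro mult_nonneg_nonneg sum_nonneg) auto
  qed (use term_bound in auto)
  also have "\<dots> = (\<Sum>\<^sub>\<infinity>\<nu>. norm (d \<nu>) * r ^ degree \<nu>) * sum G V"
    by (rule infsum_cmult_left') 
  finally show ?thesis by (simp add: G_def)
qed

lemma exp_neg_inner_real_exponent:
  "exp (- (x \<bullet> real_exponent \<nu>)) = (\<Prod>i\<in>UNIV. exp (- (x $ i)) ^ (\<nu> $ i))"
  by (simp add: inner_real_exponent sum_negf[symmetric] exp_sum exp_of_nat_mult[symmetric] mult.commute)

lemma monomial_scaled:
  assumes "\<And>i. z $ i = a $ i * of_real (exp (- (P $ i)))"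
  shows "monomial \<nu> z = monomial \<nu> a * of_real (exp (- (P \<bullet> real_exponent \<nu>)))"
  by (simp add: exp_neg_inner_real_exponent monomial_def assms power_mult_distrib prod.distrib)

lemma tendsto_monomial [tendsto_intros]:
  assumes "(a \<longlongrightarrow> b) F"
  shows "((\<lambda>k. monomial \<nu> (a k)) \<longlongrightarrow> monomial \<nu> b) F"
  unfolding monomial_def by (intro tendsto_intros assms)

text \<open>Along \<open>z\<^sub>k = a\<^sub>k exp (-P\<^sub>k)\<close> the terms with exponent in \<open>S\<close> all have size \<open>exp (-m\<^sub>k)\<close>. The remaining generators
  are of smaller order, and so is the tail by the previous bound. The weights vary
  with \<open>k\<close>, since a sequence, unlike an analytic arc, has no fixed direction.\<close>

lemma pseries_tendsto_initial_form:
  fixes a z :: "nat \<Rightarrow> complex ^ 'n" and P :: "nat \<Rightarrow> real ^ 'n"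
  assumes V: "finite V" "S \<subseteq> V"
    and dom: "\<And>\<nu>. d \<nu> \<noteq> 0 \<Longrightarrow> \<exists>v\<in>V. \<forall>i. v $ i \<le> \<nu> $ i"
    and conv: "converges_at d r" "0 < r"
    and z: "\<And>k i. z k $ i = a k $ i * of_real (exp (- (P k $ i)))"
    and lim: "a \<longlonglongrightarrow> b" "z \<longlonglongrightarrow> 0"
    and inS: "\<And>v. v \<in> S \<Longrightarrow> \<forall>\<^sub>F k in sequentially. P k \<bullet> real_exponent v = m k"
    and notS: "\<And>v. v \<in> V - S \<Longrightarrow> filterlim (\<lambda>k. P k \<bullet> real_exponent v - m k) at_top sequentially"
  shows "(\<lambda>k. of_real (exp (m k)) * pseries d (z k)) \<longlonglongrightarrow> (\<Sum>\<nu>\<in>S. d \<nu> * monomial \<nu> b)"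
proof -
  have finS: "finite S" using V finite_subset by blast
  have mon: "of_real (exp (m k)) * monomial v (z k) =
      monomial v (a k) * of_real (exp (- (P k \<bullet> real_exponent v - m k)))" for k v
    by (simp add: monomial_scaled[OF z] exp_minus exp_diff field_simps)
  have monS: "(\<lambda>k. of_real (exp (m k)) * monomial v (z k)) \<longlonglongrightarrow> monomial v b" if "v \<in> S" for v
  proof (rule Lim_transform_eventually)
    show "\<forall>\<^sub>F k in sequentially. monomial v (a k) = of_real (exp (m k)) * monomial v (z k)"
      using inS[OF that] by eventually_elim (simp add: mon)
  qed (intro tendsto_intros lim)
  have monV: "(\<lambda>k. of_real (exp (m k)) * monomial v (z k)) \<longlonglongrightarrow> 0" if "v \<in> V - S" for v
  proof -
    have "(\<lambda>k. exp (- (P k \<bullet> real_exponent v - m k))) \<longlonglongrightarrow> 0"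
      using notS[OF that]
      by (intro filterlim_compose[OF exp_at_bot]) (simp only: filterlim_uminus_at_top[symmetric])
    then have "(\<lambda>k. monomial v (a k) * of_real (exp (- (P k \<bullet> real_exponent v - m k)))) \<longlonglongrightarrow>
        monomial v b * of_real 0"
      by (intro tendsto_intros lim)
    then show ?thesis unfolding mon by simp
  qed
  define B where "B = (\<Sum>\<^sub>\<infinity>\<nu>. norm (d \<nu>) * r ^ degree \<nu>)"
  define g where "g v k = norm (of_real (exp (m k)) * monomial v (z k)) / r ^ degree v *
      (if v \<in> S then norm (z k) / r else 1)" for v k
  have g: "g v \<longlonglongrightarrow> 0" if "v \<in> V" for v
  proof (cases "v \<in> S")
    case True
    have "(\<lambda>k. norm (of_real (exp (m k)) * monomial v (z k)) / r ^ degree v * (norm (z k) / r))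
        \<longlonglongrightarrow> norm (monomial v b) / r ^ degree v * (norm (0 :: complex ^ 'n) / r)"
      using conv(2) by (intro tendsto_intros monS[OF True] lim) auto
    with True show ?thesis unfolding g_def by (simp only: if_True norm_zero mult_zero_right div_0)
  next
    case False
    with that have "v \<in> V - S" by simp
    then have "(\<lambda>k. norm (of_real (exp (m k)) * monomial v (z k)) / r ^ degree v * 1)
        \<longlonglongrightarrow> norm (0 :: complex) / r ^ degree v * 1"
      using conv(2) by (intro tendsto_intros monV) auto
    with False show ?thesis by (simp add: g_def[abs_def])
  qed
  have small: "\<forall>\<^sub>F k in sequentially. norm (z k) < r"
    using order_tendstoD(2)[OF tendsto_norm[OF lim(2)], of r] conv(2) by simp
  have "(\<lambda>k. of_real (exp (m k)) * (pseries d (z k) - (\<Sum>\<nu>\<in>S. d \<nu> * monomial \<nu> (z k)))) \<longlonglongrightarrow> 0"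
  proof (rule Lim_null_comparison)
    show "(\<lambda>k. B * (\<Sum>v\<in>V. g v k)) \<longlonglongrightarrow> 0"
      by (rule tendsto_mult_right_zero, rule tendsto_null_sum, rule g)
    show "\<forall>\<^sub>F k in sequentially. norm (of_real (exp (m k)) *
        (pseries d (z k) - (\<Sum>\<nu>\<in>S. d \<nu> * monomial \<nu> (z k)))) \<le> B * (\<Sum>v\<in>V. g v k)"
      using small
    proof eventually_elim
      case (elim k)
      have "norm (pseries d (z k) - (\<Sum>\<nu>\<in>S. d \<nu> * monomial \<nu> (z k))) \<le>
          B * (\<Sum>v\<in>V. norm (monomial v (z k)) / r ^ degree v * (if v \<in> S then norm (z k) / r else 1))"
        unfolding B_def
        by (rule pseries_remainder_bound[OF V dom conv])
           (use elim in \<open>auto intro: Finite_Cartesian_Product.norm_nth_le\<close>)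
      then have "exp (m k) * norm (pseries d (z k) - (\<Sum>\<nu>\<in>S. d \<nu> * monomial \<nu> (z k))) \<le> exp (m k) *
          (B * (\<Sum>v\<in>V. norm (monomial v (z k)) / r ^ degree v * (if v \<in> S then norm (z k) / r else 1)))"
        by (intro mult_left_mono) auto
      also have "\<dots> = B * (\<Sum>v\<in>V. g v k)"
        by (simp add: g_def norm_mult sum_distrib_left mult_ac)
      finally show ?case by (simp add: norm_mult)
    qed
  qed
  moreover have "(\<lambda>k. \<Sum>\<nu>\<in>S. d \<nu> * (of_real (exp (m k)) * monomial \<nu> (z k))) \<longlonglongrightarrow> (\<Sum>\<nu>\<in>S. d \<nu> * monomial \<nu> b)"
    by (intro tendsto_intros monS)
  ultimately have "(\<lambda>k. of_real (exp (m k)) * (pseries d (z k) - (\<Sum>\<nu>\<in>S. d \<nu> * monomial \<nu> (z k))) +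
      (\<Sum>\<nu>\<in>S. d \<nu> * (of_real (exp (m k)) * monomial \<nu> (z k)))) \<longlonglongrightarrow> 0 + (\<Sum>\<nu>\<in>S. d \<nu> * monomial \<nu> b)"
    by (rule tendsto_add)
  then show ?thesis by (simp add: right_diff_distrib sum_distrib_left mult_ac)
qed

text \<open>Extending the coefficients of a face by 0 makes its face function a power series over all
  exponents, so the preceding lemmas apply to it.\<close>

definition face_coeff :: "(nat ^ 'n \<Rightarrow> complex) \<Rightarrow> real ^ 'n \<Rightarrow> nat ^ 'n \<Rightarrow> complex" where
  "face_coeff c P \<nu> = (if \<nu> \<in> face_exponents c P then c \<nu> else 0)"

lemma face_fun_eq_pseries: "face_fun c P = pseries (face_coeff c P)"
  unfolding face_fun_def[abs_def] pseries_def[abs_def]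
  by (intro ext infsum_cong_neutral) (auto simp: face_coeff_def)

lemma converges_at_face_coeff:
  assumes "converges_at c r" "0 \<le> r"
  shows "converges_at (face_coeff c P) r"
  unfolding converges_at_def
  by (rule summable_on_comparison_test[OF assms(1)[unfolded converges_at_def]])
     (use assms(2) in \<open>auto simp: face_coeff_def\<close>)

lemma open_polydisc: "open {z :: complex ^ 'n. \<forall>i. norm (z $ i) < r}"
proof -
  have "open (\<Inter>i\<in>UNIV. {z :: complex ^ 'n. norm (z $ i) < r})"
    by (rule open_INT) (auto intro!: open_Collect_less continuous_intros)
  moreover have "(\<Inter>i\<in>UNIV. {z :: complex ^ 'n. norm (z $ i) < r}) = {z. \<forall>i. norm (z $ i) < r}" by auto
  ultimately show ?thesis by simp
qed

lemma polydisc_in_face_domain: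
  assumes "converges_at (face_coeff c P) r" "\<And>i. norm (z $ i) < r"
  shows "z \<in> face_domain c P"
  unfolding face_domain_def
proof (rule interiorI[OF open_polydisc])
  show "z \<in> {z. \<forall>i. norm (z $ i) < r}" using assms(2) by simp
  show "{z. \<forall>i. norm (z $ i) < r} \<subseteq> {z. (\<lambda>\<nu>. c \<nu> * monomial \<nu> z) summable_on face_exponents c P}"
  proof clarify
    fix w :: "complex ^ 'a" assume "\<forall>i. norm (w $ i) < r"
    then have "(\<lambda>\<nu>. face_coeff c P \<nu> * monomial \<nu> w) summable_on face_exponents c P"
      by (intro pseries_summable[OF assms(1)]) (auto intro: less_imp_le)
    then show "(\<lambda>\<nu>. c \<nu> * monomial \<nu> w) summable_on face_exponents c P"
      by (subst summable_on_cong) (auto simp: face_coeff_def)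
  qed
qed

context exponent_generators
begin

definition initial_generators :: "real ^ 'n \<Rightarrow> (nat ^ 'n) set" where
  "initial_generators P = {v \<in> V. P \<bullet> real_exponent v = min_weight c P}"

lemma finite_initial_generators: "finite (initial_generators P)"
  using finite_V by (simp add: initial_generators_def)

lemma face_exponents_iff: "c \<nu> \<noteq> 0 \<Longrightarrow> \<nu> \<in> face_exponents c P \<longleftrightarrow> P \<bullet> real_exponent \<nu> = min_weight c P"
  by (simp add: face_exponents_def real_exponent_in_face_iff)

text \<open>The face of a positive weight is compact: adding anything to a generator increases the weight.\<close>

lemma face_coeff_support_positive:
  assumes P: "P \<in> positive_weights" and "face_coeff c P \<nu> \<noteq> 0"
  shows "\<nu> \<in> initial_generators P"
proof -
  have W: "P \<in> weights" and pos: "0 < P $ i" for i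
    using P by (auto simp: positive_weights_def vanishing_indices_def weights_def less_le)
  have \<nu>: "c \<nu> \<noteq> 0" "P \<bullet> real_exponent \<nu> = min_weight c P"
    using assms(2) face_exponents_iff by (auto simp: face_coeff_def split: if_splits)
  obtain v where v: "v \<in> V" "\<And>i. v $ i \<le> \<nu> $ i" using V_dominates \<nu>(1) by blast
  have "v = \<nu>"
  proof (rule ccontr)
    assume "v \<noteq> \<nu>"
    then obtain i where i: "v $ i \<noteq> \<nu> $ i" by (auto simp: vec_eq_iff)
    have "P \<bullet> real_exponent v < P \<bullet> real_exponent \<nu>"
      unfolding inner_real_exponent
    proof (rule sum_strict_mono_ex1)
      show "\<forall>i\<in>UNIV. P $ i * real (v $ i) \<le> P $ i * real (\<nu> $ i)"
        using v(2) pos by (simp add: less_imp_le)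
      show "\<exists>i\<in>UNIV. P $ i * real (v $ i) < P $ i * real (\<nu> $ i)"
        using v(2)[of i] i pos[of i] by (intro bexI[of _ i]) auto
    qed simp
    with min_weight_le_V[OF W v(1)] \<nu>(2) show False by simp
  qed
  with v(1) \<nu>(2) show ?thesis by (simp add: initial_generators_def)
qed

lemma face_coeff_initial: "v \<in> initial_generators P \<Longrightarrow> face_coeff c P v = c v"
  using V_support by (auto simp: face_coeff_def initial_generators_def face_exponents_iff)

lemma converges_at_face_coeff_positive:
  assumes "P \<in> positive_weights"
  shows "converges_at (face_coeff c P) r"
  unfolding converges_at_def
proof (rule finite_nonzero_values_imp_summable_on, rule finite_subset)
  show "{\<nu>\<in>UNIV. norm (face_coeff c P \<nu>) * r ^ degree \<nu> \<noteq> 0} \<subseteq> initial_generators P"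
    using face_coeff_support_positive[OF assms] by auto
qed (rule finite_initial_generators)

text \<open>The face function of a positive weight is a polynomial, with exponents in \<open>V\<close>.\<close>

lemma euler_face_fun_positive:
  assumes "P \<in> positive_weights"
  shows "a $ j * partial (face_fun c P) j a = (\<Sum>\<nu>\<in>initial_generators P. c \<nu> * of_nat (\<nu> $ j) * monomial \<nu> a)"
proof -
  have "norm (a $ i) < norm a + 1" for i
    using Finite_Cartesian_Product.norm_nth_le[of a i] by linarith
  then have "a $ j * partial (face_fun c P) j a = pseries (\<lambda>\<nu>. face_coeff c P \<nu> * of_nat (\<nu> $ j)) a"
    unfolding face_fun_eq_pseries
    by (rule euler_partial_pseries[OF converges_at_face_coeff_positive[OF assms]])
  also have "\<dots> = (\<Sum>\<^sub>\<infinity>\<nu>\<in>initial_generators P. c \<nu> * of_nat (\<nu> $ j) * monomial \<nu> a)"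
    unfolding pseries_def
    by (rule infsum_cong_neutral)
      (use face_coeff_support_positive[OF assms] face_coeff_initial in auto)
  finally show ?thesis by (simp add: finite_initial_generators)
qed

lemma face_domain_positive: "P \<in> positive_weights \<Longrightarrow> z \<in> face_domain c P"
proof -
  assume P: "P \<in> positive_weights"
  have "norm (z $ i) < norm z + 1" for i
    using Finite_Cartesian_Product.norm_nth_le[of z i] by linarith
  then show ?thesis by (rule polydisc_in_face_domain[OF converges_at_face_coeff_positive[OF P]])
qed

text \<open>The initial form of \<open>f\<^sub>Q\<close> with respect to \<open>P\<close> is \<open>f\<^sub>P\<close>. So \<open>z\<^sub>j \<partial>\<^sub>j f\<^sub>Q\<close> is asymptotic to a nonzero multiple of
  \<open>exp (-k d(P))\<close> at the points \<open>a exp (-k P)\<close>, which enter the domain of convergence of \<open>f\<^sub>Q\<close>.\<close>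

lemma face_vars_superface:
  assumes P: "P \<in> positive_weights" and sub: "face c P \<subseteq> face c Q"
    and conv: "converges_at c r" "0 < r"
    and a: "a \<in> torus" "partial (face_fun c P) j a \<noteq> 0"
  shows "j \<in> face_vars c Q"
proof -
  have W: "P \<in> weights" and pos: "0 < P $ i" for i
    using P by (auto simp: positive_weights_def vanishing_indices_def weights_def less_le)
  define z where "z k = (\<chi> i. a $ i * of_real (exp (- ((real k *\<^sub>R P) $ i))))" for k
  let ?S = "initial_generators P" and ?d = "\<lambda>\<nu>. face_coeff c Q \<nu> * of_nat (\<nu> $ j)"
  have "z \<longlonglongrightarrow> 0"
  proof (rule vec_tendstoI)
    fix i
    have "filterlim (\<lambda>k. real k * P $ i) at_top sequentially"
      by (rule filterlim_at_top_mult_tendsto_pos[OF tendsto_const pos filterlim_real_sequentially])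
    then have "(\<lambda>k. exp (- (real k * P $ i))) \<longlonglongrightarrow> 0"
      by (intro filterlim_compose[OF exp_at_bot]) (simp only: filterlim_uminus_at_top[symmetric])
    then have "(\<lambda>k. a $ i * of_real (exp (- (real k * P $ i)))) \<longlonglongrightarrow> a $ i * of_real 0"
      by (intro tendsto_intros)
    then show "(\<lambda>k. z k $ i) \<longlonglongrightarrow> 0 $ i" by (simp add: z_def)
  qed
  note z0 = this
  have cQ: "converges_at (face_coeff c Q) r" using conv by (intro converges_at_face_coeff) auto
  have d: "converges_at ?d (r / 2)" using converges_at_mult_exponent[OF cQ, of j] conv by simp
  have "(\<lambda>k. of_real (exp (real k * min_weight c P)) * pseries ?d (z k)) \<longlonglongrightarrow> (\<Sum>\<nu>\<in>?S. ?d \<nu> * monomial \<nu> a)"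
  proof (rule pseries_tendsto_initial_form[OF finite_V _ _ d])
    show "?S \<subseteq> V" by (auto simp: initial_generators_def)
    show "\<exists>v\<in>V. \<forall>i. v $ i \<le> \<nu> $ i" if "?d \<nu> \<noteq> 0" for \<nu>
      using that by (intro V_dominates) (auto simp: face_coeff_def split: if_splits)
    show "filterlim (\<lambda>k. (real k *\<^sub>R P) \<bullet> real_exponent v - real k * min_weight c P) at_top sequentially"
      if "v \<in> V - ?S" for v
    proof -
      have "0 < P \<bullet> real_exponent v - min_weight c P"
        using that min_weight_le_V[OF W, of v] by (auto simp: initial_generators_def)
      then have "filterlim (\<lambda>k. real k * (P \<bullet> real_exponent v - min_weight c P)) at_top sequentially"
        by (rule filterlim_at_top_mult_tendsto_pos[OF tendsto_const _ filterlim_real_sequentially])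
      then show ?thesis by (simp add: right_diff_distrib)
    qed
    show "z \<longlonglongrightarrow> 0" by (rule z0)
    show "(\<lambda>k. a) \<longlonglongrightarrow> a" by (rule tendsto_const)
  qed (use conv in \<open>auto simp: z_def initial_generators_def\<close>)
  moreover have "(\<Sum>\<nu>\<in>?S. ?d \<nu> * monomial \<nu> a) = a $ j * partial (face_fun c P) j a"
    unfolding euler_face_fun_positive[OF P]
  proof (rule sum.cong[OF refl])
    fix \<nu> assume "\<nu> \<in> ?S"
    then have "real_exponent \<nu> \<in> face c P"
      using V_support by (simp add: initial_generators_def real_exponent_in_face_iff)
    with sub have "face_coeff c Q \<nu> = c \<nu>" by (auto simp: face_coeff_def face_exponents_def)
    then show "?d \<nu> * monomial \<nu> a = c \<nu> * of_nat (\<nu> $ j) * monomial \<nu> a" by simp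
  qed
  moreover have "a $ j * partial (face_fun c P) j a \<noteq> 0" using a by (auto simp: torus_def)
  ultimately have "\<forall>\<^sub>F k in sequentially. of_real (exp (real k * min_weight c P)) * pseries ?d (z k) \<noteq> 0"
    by (intro tendsto_imp_eventually_ne) auto
  moreover have "\<forall>\<^sub>F k in sequentially. norm (z k) < r"
    using order_tendstoD(2)[OF tendsto_norm[OF z0], of r] conv(2) by simp
  ultimately have "\<forall>\<^sub>F k in sequentially. pseries ?d (z k) \<noteq> 0 \<and> norm (z k) < r"
    by eventually_elim auto
  then obtain k where k: "pseries ?d (z k) \<noteq> 0" "norm (z k) < r"
    using eventually_happens' sequentially_bot by blast
  have zk: "norm (z k $ i) < r" for i
    using Finite_Cartesian_Product.norm_nth_le[of "z k" i] k(2) by linarith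
  have "z k $ j * partial (face_fun c Q) j (z k) = pseries ?d (z k)"
    unfolding face_fun_eq_pseries by (rule euler_partial_pseries[OF cQ zk])
  with k(1) have "partial (face_fun c Q) j (z k) \<noteq> 0" by auto
  with polydisc_in_face_domain[OF cQ zk] show ?thesis by (auto simp: face_vars_def)
qed

section \<open>Vertices and reduced variables\<close>

lemma face_eq_vertex:
  assumes P: "P \<in> positive_weights" and S: "initial_generators P = {\<nu>}"
  shows "face c P = {real_exponent \<nu>}"
proof -
  have W: "P \<in> weights" and pos: "P $ i \<noteq> 0" for i
    using P by (auto simp: positive_weights_def vanishing_indices_def)
  have "x = real_exponent \<nu>" if x: "x \<in> face c P" for x
  proof -
    from face_decompose[OF W x] obtain \<kappa> y where *: "sum \<kappa> V = 1"
      "x = (\<Sum>v\<in>V. \<kappa> v *\<^sub>R real_exponent v) + y"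
      "\<forall>v\<in>V. \<kappa> v = 0 \<or> P \<bullet> real_exponent v = min_weight c P" "\<forall>i. P $ i = 0 \<or> y $ i = 0" by blast
    have y: "y = 0" using *(4) pos by (simp add: vec_eq_iff)
    have k: "\<kappa> v = 0" if "v \<in> V - {\<nu>}" for v
      using *(3) S that by (auto simp: initial_generators_def)
    have \<nu>: "\<nu> \<in> V" using S by (auto simp: initial_generators_def)
    have "sum \<kappa> V = \<kappa> \<nu>" using \<nu> k finite_V by (simp add: sum.remove[of V \<nu>])
    moreover have "(\<Sum>v\<in>V. \<kappa> v *\<^sub>R real_exponent v) = \<kappa> \<nu> *\<^sub>R real_exponent \<nu>"
      using \<nu> k finite_V by (simp add: sum.remove[of V \<nu>])
    ultimately show ?thesis using * y by simp
  qed
  with face_nonempty[OF W] show ?thesis by blast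
qed

lemma vertex_in_V:
  assumes "P \<in> weights" "face c P = {real_exponent \<nu>}"
  shows "\<nu> \<in> V" "initial_generators P = {\<nu>}"
proof -
  have *: "v = \<nu>" if "v \<in> V" "P \<bullet> real_exponent v = min_weight c P" for v
    using that assms(2) V_support real_exponent_in_face_iff by (metis real_exponent_eq_iff singletonD)
  from min_weight_attained[OF assms(1)] obtain v where v: "v \<in> V" "P \<bullet> real_exponent v = min_weight c P" .
  with *[OF v] show "\<nu> \<in> V" "initial_generators P = {\<nu>}" using * by (auto simp: initial_generators_def)
qed

lemma zero_dim_face_vertex:
  assumes "P \<in> weights" "aff_dim (face c P) = 0"
  obtains \<nu> where "\<nu> \<in> V" "P \<bullet> real_exponent \<nu> = min_weight c P" "face c P = {real_exponent \<nu>}"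
    "initial_generators P = {\<nu>}"
proof -
  from assms(2) obtain x where x: "face c P = {x}" by (auto simp: aff_dim_eq_0)
  from min_weight_attained[OF assms(1)] obtain \<nu>
    where \<nu>: "\<nu> \<in> V" "P \<bullet> real_exponent \<nu> = min_weight c P" .
  then have "real_exponent \<nu> \<in> face c P" by (simp add: real_exponent_in_face_iff V_support)
  with x have "face c P = {real_exponent \<nu>}" by simp
  with that \<nu> vertex_in_V(2)[OF assms(1) this] show thesis by blast
qed

text \<open>The positive orthant is not covered by the finitely many hyperplanes on which two generators
  have equal weight. This shows that vertices, and hence facets, exist; the maxima over them would
  otherwise be unspecified.\<close>

lemma generic_weight:
  obtains P \<nu> where "P \<in> positive_weights" "initial_generators P = {\<nu>}"
proof -
  define H where "H = (\<Union>(v, w)\<in>{(v, w) \<in> V \<times> V. v \<noteq> w}. {P. (real_exponent v - real_exponent w) \<bullet> P = 0})"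
  have "negligible H"
    unfolding H_def
  proof (rule negligible_Union)
    have "finite {(v, w) \<in> V \<times> V. v \<noteq> w}"
      by (rule finite_subset[OF _ finite_cartesian_product[OF finite_V finite_V]]) auto
    then show "finite ((\<lambda>(v, w). {P. (real_exponent v - real_exponent w) \<bullet> P = 0}) ` {(v, w) \<in> V \<times> V. v \<noteq> w})"
      by (rule finite_imageI)
  qed (auto intro!: negligible_hyperplane)
  moreover have "open {P :: real ^ 'n. \<forall>i. 0 < P $ i}"
  proof -
    have "open (\<Inter>i\<in>UNIV. {P :: real ^ 'n. 0 < P $ i})"
      by (rule open_INT) (auto intro!: open_Collect_less continuous_intros)
    moreover have "(\<Inter>i\<in>UNIV. {P :: real ^ 'n. 0 < P $ i}) = {P. \<forall>i. 0 < P $ i}" by auto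
    ultimately show ?thesis by simp
  qed
  moreover have "(\<chi> i. 1) \<in> {P :: real ^ 'n. \<forall>i. 0 < P $ i}" by simp
  ultimately have "\<not> {P. \<forall>i. 0 < P $ i} \<subseteq> H"
    using open_not_negligible negligible_subset by blast
  then obtain P where P: "\<And>i. 0 < P $ i" "P \<notin> H" by blast
  have pos: "P \<in> positive_weights"
    using P(1) by (auto simp: positive_weights_def weights_def vanishing_indices_def less_imp_le less_imp_neq[symmetric])
  then have W: "P \<in> weights" by (simp add: positive_weights_def)
  from min_weight_attained[OF W] obtain \<nu> where \<nu>: "\<nu> \<in> V" "P \<bullet> real_exponent \<nu> = min_weight c P" .
  have "v = \<nu>" if "v \<in> V" "P \<bullet> real_exponent v = min_weight c P" for v
  proof (rule ccontr)
    assume "v \<noteq> \<nu>"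
    moreover have "(real_exponent v - real_exponent \<nu>) \<bullet> P = 0"
      using that \<nu> by (simp add: inner_commute[of _ P] inner_diff_right)
    ultimately have "P \<in> H" using that \<nu> by (force simp: H_def)
    with P(2) show False by simp
  qed
  then have "initial_generators P = {\<nu>}" using \<nu> unfolding initial_generators_def by blast
  with pos show thesis by (rule that)
qed

text \<open>A vanishing weight that competes for the larger face competes for the smaller one.\<close>

lemma ext_vanishing_superface:
  assumes "face c P \<subseteq> face c Q"
  shows "ext_vanishing_indices c Q \<subseteq> ext_vanishing_indices c P"
proof
  fix i assume "i \<in> ext_vanishing_indices c Q"
  then obtain R where R: "R \<in> vanishing_weights c" "i \<in> vanishing_indices R"
    "face c Q \<subset> face c R \<or> weight_class c R = weight_class c Q"
    unfolding ext_vanishing_indices_def by blast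
  have "R \<in> weights" using R(1) by (simp add: vanishing_weights_def)
  then have "weight_class c R = weight_class c Q \<Longrightarrow> face c R = face c Q"
    by (auto simp: weight_class_def)
  with R(3) assms have "face c P \<subseteq> face c R" by blast
  then have "face c P \<subset> face c R \<or> weight_class c R = weight_class c P"
    by (auto simp: weight_class_def)
  with R show "i \<in> ext_vanishing_indices c P" unfolding ext_vanishing_indices_def by blast
qed

text \<open>A weight vector \<open>P\<close> with a zero coordinate is itself one of the vanishing weights whose indices
  are removed.\<close>

lemma reduced_vars_weight_pos:
  assumes "P \<in> positive_weights \<union> vanishing_weights c" "j \<in> reduced_vars c P"
  shows "0 < P $ j"
proof (rule ccontr)
  assume "\<not> 0 < P $ j"
  moreover have "0 \<le> P $ j" using assms(1)
    by (auto simp: positive_weights_def vanishing_weights_def weights_def)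
  ultimately have j: "j \<in> vanishing_indices P" by (simp add: vanishing_indices_def)
  with assms(1) have "P \<in> vanishing_weights c" by (auto simp: positive_weights_def)
  with j have "j \<in> ext_vanishing_indices c P" unfolding ext_vanishing_indices_def by blast
  with assms(2) show False by (simp add: reduced_vars_def)
qed

lemma vertex_partial_nonzero:
  assumes "P \<in> positive_weights" "initial_generators P = {\<nu>}" "\<nu> $ j > 0" "a \<in> torus"
  shows "partial (face_fun c P) j a \<noteq> 0"
proof -
  have "c \<nu> \<noteq> 0" using assms(2) V_support by (auto simp: initial_generators_def)
  moreover have "monomial \<nu> a \<noteq> 0" using assms(4) by (simp add: monomial_def torus_def)
  ultimately have "a $ j * partial (face_fun c P) j a \<noteq> 0"
    using assms(3) by (simp add: euler_face_fun_positive[OF assms(1)] assms(2))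
  then show ?thesis by auto
qed

end

section \<open>The two bounds on the exponent\<close>

text \<open>A convergent, strongly inv-tame series without constant term, together with a radius of convergence.\<close>

locale tame_series = exponent_generators c V for c :: "nat ^ 'n \<Rightarrow> complex" and V +
  fixes r :: real
  assumes conv: "converges_at c r" and r_pos: "0 < r"
    and c_0: "c 0 = 0"
    and tame: "strongly_inv_tame c"
begin

text \<open>The sets whose maxima are \<open>vertex_bound c\<close> and \<open>facet_bound c\<close>. They are finite and nonempty, so the
  maxima are attained.\<close>

definition vertex_exponents :: "real set" where
  "vertex_exponents = {1 - 1 / real (\<Sum>i\<in>UNIV. \<nu> $ i) | P \<nu>.
       P \<in> weights \<and> weight_class c P \<in> vertex_classes c \<and> face c P = {real_exponent \<nu>}}"

definition facet_exponents :: "real set" where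
  "facet_exponents = {1 - min_reduced_weight c P | P.
       P \<in> positive_weights \<union> vanishing_weights c \<and> aff_dim (face c P) = int CARD('n) - 1}"

lemma generator_exponent_pos: "v \<in> V \<Longrightarrow> \<exists>i. 0 < v $ i"
proof -
  assume "v \<in> V"
  then have "v \<noteq> 0" using V_support c_0 by auto
  then show ?thesis by (auto simp: vec_eq_iff)
qed

lemma generator_degree: "v \<in> V \<Longrightarrow> 0 < degree v"
  using generator_exponent_pos[of v] by (auto intro: sum_pos2)

lemma min_weight_pos:
  assumes "P \<in> positive_weights"
  shows "0 < min_weight c P"
proof -
  have W: "P \<in> weights" and pos: "0 < P $ i" for i
    using assms by (auto simp: positive_weights_def vanishing_indices_def weights_def less_le)
  from min_weight_attained[OF W] obtain v where v: "v \<in> V" "P \<bullet> real_exponent v = min_weight c P" .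
  from generator_exponent_pos[OF v(1)] obtain i where i: "v $ i > 0" by blast
  have "0 < P \<bullet> real_exponent v"
    unfolding inner_real_exponent by (rule sum_pos2[of _ i]) (use i pos in \<open>auto simp: less_imp_le\<close>)
  with v show ?thesis by simp
qed

lemma vertex_exponent_mem:
  assumes "P \<in> weights" "face c P = {real_exponent \<nu>}"
  shows "1 - 1 / real (degree \<nu>) \<in> vertex_exponents"
proof -
  have "class_dim c P = int CARD('n)" using assms by (simp add: class_dim_def)
  with assms show ?thesis unfolding vertex_exponents_def vertex_classes_def by blast
qed

lemma finite_vertex_exponents: "finite vertex_exponents"
proof (rule finite_subset)
  show "vertex_exponents \<subseteq> (\<lambda>\<nu>. 1 - 1 / real (degree \<nu>)) ` V"
    unfolding vertex_exponents_def using vertex_in_V(1) by blast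
qed (simp add: finite_V)

lemma vertex_bound_ge:
  assumes "P \<in> weights" "face c P = {real_exponent \<nu>}"
  shows "1 - 1 / real (degree \<nu>) \<le> vertex_bound c"
  unfolding vertex_bound_def vertex_exponents_def[symmetric]
  by (rule Max_ge[OF finite_vertex_exponents vertex_exponent_mem[OF assms]])

lemma vertex_bound_range: "0 \<le> vertex_bound c" "vertex_bound c < 1"
proof -
  obtain P \<nu> where P: "P \<in> positive_weights" "initial_generators P = {\<nu>}" by (rule generic_weight)
  then have "vertex_exponents \<noteq> {}"
    using vertex_exponent_mem[OF _ face_eq_vertex[OF P]] by (auto simp: positive_weights_def)
  then have "vertex_bound c \<in> vertex_exponents"
    unfolding vertex_bound_def vertex_exponents_def[symmetric] by (rule Max_in[OF finite_vertex_exponents])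
  then obtain \<nu> where \<nu>: "\<nu> \<in> V" "vertex_bound c = 1 - 1 / real (degree \<nu>)"
    unfolding vertex_exponents_def using vertex_in_V(1) by blast
  have "1 \<le> real (degree \<nu>)" using generator_degree[OF \<nu>(1)] by linarith
  then show "0 \<le> vertex_bound c" "vertex_bound c < 1" unfolding \<nu>(2) by (simp_all add: field_simps)
qed

lemma finite_facet_exponents: "finite facet_exponents"
proof (rule finite_subset)
  let ?N = "{normalized c P | P. P \<in> weights \<and> min_weight c P > 0 \<and> aff_dim (face c P) = int CARD('n) - 1}"
  let ?g = "\<lambda>(N, J). 1 - Min ((\<lambda>j. N $ j) ` J)"
  show "facet_exponents \<subseteq> ?g ` (?N \<times> UNIV)"
  proof
    fix x assume "x \<in> facet_exponents"
    then obtain P where P: "x = 1 - min_reduced_weight c P" "P \<in> positive_weights \<union> vanishing_weights c"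
      "aff_dim (face c P) = int CARD('n) - 1" unfolding facet_exponents_def by blast
    have "P \<in> weights" "min_weight c P > 0"
      using P(2) min_weight_pos by (auto simp: positive_weights_def vanishing_weights_def)
    with P(3) have "(normalized c P, reduced_vars c P) \<in> ?N \<times> UNIV" by blast
    moreover have "x = ?g (normalized c P, reduced_vars c P)"
      by (simp add: P(1) min_reduced_weight_def)
    ultimately show "x \<in> ?g ` (?N \<times> UNIV)" by blast
  qed
  show "finite (?g ` (?N \<times> UNIV))" using finite_normalized_facets by simp
qed

lemma facet_bound_ge:
  assumes "Q \<in> positive_weights \<union> vanishing_weights c" "aff_dim (face c Q) = int CARD('n) - 1"
    "j \<in> reduced_vars c Q"
  shows "1 - normalized c Q $ j \<le> facet_bound c"
proof -
  have "min_reduced_weight c Q \<le> normalized c Q $ j"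
    unfolding min_reduced_weight_def using assms(3) by (intro Min_le) auto
  moreover have "1 - min_reduced_weight c Q \<in> facet_exponents"
    unfolding facet_exponents_def using assms by blast
  then have "1 - min_reduced_weight c Q \<le> facet_bound c"
    unfolding facet_bound_def facet_exponents_def[symmetric] by (rule Max_ge[OF finite_facet_exponents])
  ultimately show ?thesis by linarith
qed

lemma positive_or_vanishing_weight:
  "Q \<in> weights \<Longrightarrow> 0 < min_weight c Q \<Longrightarrow> Q \<in> positive_weights \<union> vanishing_weights c"
  by (auto simp: positive_weights_def vanishing_weights_def)

text \<open>In dimension at least 2 this is part of strong inv-tameness. In dimension 1 the tameness
  condition is void for the only facet, a point \<open>\<nu> > 0\<close>, but there is no vanishing weight and the
  derivative of \<open>z\<^sup>\<nu>\<close> is not zero.\<close>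

lemma facet_reduced_vars_nonempty:
  assumes P: "P \<in> positive_weights \<union> vanishing_weights c" "aff_dim (face c P) = int CARD('n) - 1"
  shows "reduced_vars c P \<noteq> {}"
proof (cases "aff_dim (face c P) \<ge> 1")
  case True
  with tame P show ?thesis unfolding strongly_inv_tame_def by blast
next
  case False
  have card: "CARD('n) > 0" by (rule zero_less_card_finite)
  with False P(2) have one: "CARD('n) = 1" and aff: "aff_dim (face c P) = 0" by linarith+
  have none: "Q \<notin> vanishing_weights c" for Q
  proof
    assume Q: "Q \<in> vanishing_weights c"
    then obtain i where i: "Q $ i = 0" by (auto simp: vanishing_weights_def vanishing_indices_def)
    from one obtain u where "(UNIV :: 'n set) = {u}" using card_1_singletonE by blast
    with i have "Q $ k = 0" for k by (metis UNIV_I singletonD)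
    then have "Q = 0" by (simp add: vec_eq_iff)
    moreover have W: "Q \<in> weights" using Q by (simp add: vanishing_weights_def)
    ultimately have "min_weight c Q = 0" using min_weight_attained[OF W] by force
    with Q show False by (simp add: vanishing_weights_def)
  qed
  then have pos: "P \<in> positive_weights" using P(1) by blast
  then have W: "P \<in> weights" by (simp add: positive_weights_def)
  from zero_dim_face_vertex[OF W aff] obtain \<nu> where \<nu>: "\<nu> \<in> V" and S: "initial_generators P = {\<nu>}" .
  from generator_exponent_pos[OF \<nu>] obtain j where j: "\<nu> $ j > 0" by blast
  have "(\<chi> i. 1) \<in> torus" by (simp add: torus_def)
  then have "j \<in> face_vars c P"
    using vertex_partial_nonzero[OF pos S j] face_domain_positive[OF pos] unfolding face_vars_def by blast
  moreover have "ext_vanishing_indices c P = {}" using none unfolding ext_vanishing_indices_def by blast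
  ultimately show ?thesis by (auto simp: reduced_vars_def)
qed

lemma facet_bound_less_1: "facet_bound c < 1"
proof -
  obtain P \<nu> where P: "P \<in> positive_weights" "initial_generators P = {\<nu>}" by (rule generic_weight)
  then have "P \<in> weights" by (simp add: positive_weights_def)
  from facet_below_weight[OF this min_weight_pos[OF P(1)]]
  obtain Q where Q: "Q \<in> weights" "min_weight c Q = 1" "aff_dim (face c Q) = int CARD('n) - 1" by blast
  then have "facet_exponents \<noteq> {}" using positive_or_vanishing_weight[of Q] unfolding facet_exponents_def by auto
  then have "facet_bound c \<in> facet_exponents"
    unfolding facet_bound_def facet_exponents_def[symmetric] by (rule Max_in[OF finite_facet_exponents])
  then obtain R where R: "facet_bound c = 1 - min_reduced_weight c R"
    "R \<in> positive_weights \<union> vanishing_weights c" "aff_dim (face c R) = int CARD('n) - 1"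
    unfolding facet_exponents_def by blast
  have m: "0 < min_weight c R" using R(2) min_weight_pos by (auto simp: vanishing_weights_def)
  have "min_reduced_weight c R \<in> (\<lambda>j. normalized c R $ j) ` reduced_vars c R"
    unfolding min_reduced_weight_def
    by (rule Min_in) (use facet_reduced_vars_nonempty[OF R(2,3)] in auto)
  then obtain j where "j \<in> reduced_vars c R" "min_reduced_weight c R = normalized c R $ j" by blast
  with reduced_vars_weight_pos[OF R(2)] m have "0 < min_reduced_weight c R"
    by (simp add: normalized_def)
  with R(1) show ?thesis by simp
qed

text \<open>The combinatorial core. On a face of positive dimension \<open>j\<close> comes from tameness and is compared with a facet; at a
  vertex \<open>\<nu>\<close> the average of the \<open>P\<^sub>i\<close>, weighted by \<open>\<nu>\<^sub>i\<close>, is \<open>d(P) / |\<nu>|\<close>, so some \<open>P\<^sub>j\<close> with \<open>\<nu>\<^sub>j > 0\<close> is at least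
  as large.\<close>

lemma tame_weight_bound:
  assumes P: "P \<in> positive_weights" and a: "a \<in> torus"
  shows "\<exists>j. partial (face_fun c P) j a \<noteq> 0 \<and>
    (1 - max (vertex_bound c) (facet_bound c)) * min_weight c P \<le> P $ j"
proof -
  have W: "P \<in> weights" and pos: "0 < P $ i" for i
    using P by (auto simp: positive_weights_def vanishing_indices_def weights_def less_le)
  have m: "0 < min_weight c P" by (rule min_weight_pos[OF P])
  show ?thesis
  proof (cases "aff_dim (face c P) \<ge> 1")
    case True
    then obtain j where j: "j \<in> reduced_vars c P" "partial (face_fun c P) j a \<noteq> 0"
      using tame P a face_domain_positive[OF P, of a] unfolding strongly_inv_tame_def by blast
    \<comment> \<open>Passing to the facet keeps \<open>j\<close> reduced: its face is larger, so it has more variables and fewer competing vanishing weights.\<close>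
    from facet_below_weight[OF W m, of j] obtain Q where Q: "Q \<in> weights" "min_weight c Q = 1"
      "aff_dim (face c Q) = int CARD('n) - 1"
      "\<And>v. v \<in> V \<Longrightarrow> P \<bullet> real_exponent v = min_weight c P \<Longrightarrow> Q \<bullet> real_exponent v = 1"
      "Q $ j \<le> normalized c P $ j" by blast
    have sub: "face c P \<subseteq> face c Q"
      by (rule face_subset[OF W]) (use Q(2,4) pos in \<open>auto simp: less_imp_neq[symmetric]\<close>)
    have "j \<in> face_vars c Q" by (rule face_vars_superface[OF P sub conv r_pos a j(2)])
    moreover have "j \<notin> ext_vanishing_indices c Q"
      using j(1) ext_vanishing_superface[OF sub] by (auto simp: reduced_vars_def)
    ultimately have "j \<in> reduced_vars c Q" by (simp add: reduced_vars_def)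
    from facet_bound_ge[OF positive_or_vanishing_weight[OF Q(1)] Q(3) this] Q(2)
    have "1 - Q $ j \<le> facet_bound c" by (simp add: normalized_def)
    with Q(5) have "1 - max (vertex_bound c) (facet_bound c) \<le> P $ j / min_weight c P"
      by (simp add: normalized_def)
    then have "(1 - max (vertex_bound c) (facet_bound c)) * min_weight c P \<le> P $ j"
      using m by (simp add: pos_le_divide_eq)
    with j(2) show ?thesis by blast
  next
    case False
    have "0 \<le> aff_dim (face c P)" using face_nonempty[OF W] aff_dim_negative_iff[of "face c P"] by linarith
    with False have "aff_dim (face c P) = 0" by linarith
    from zero_dim_face_vertex[OF W this] obtain \<nu> where \<nu>: "\<nu> \<in> V" "P \<bullet> real_exponent \<nu> = min_weight c P"
      and face: "face c P = {real_exponent \<nu>}" and S: "initial_generators P = {\<nu>}" .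
    have deg: "0 < degree \<nu>" by (rule generator_degree[OF \<nu>(1)])
    have ne: "{j. 0 < \<nu> $ j} \<noteq> {}" using generator_exponent_pos[OF \<nu>(1)] by blast
    define M where "M = Max ((\<lambda>j. P $ j) ` {j. 0 < \<nu> $ j})"
    have "M \<in> (\<lambda>j. P $ j) ` {j. 0 < \<nu> $ j}" unfolding M_def by (rule Max_in) (use ne in auto)
    then obtain j where j: "0 < \<nu> $ j" "M = P $ j" by blast
    have le: "P $ i * real (\<nu> $ i) \<le> P $ j * real (\<nu> $ i)" for i
    proof (cases "\<nu> $ i = 0")
      case False
      then have "P $ i \<le> M" unfolding M_def by (intro Max_ge) auto
      with j(2) show ?thesis by (intro mult_right_mono) auto
    qed simp
    have "min_weight c P \<le> (\<Sum>i\<in>UNIV. P $ j * real (\<nu> $ i))"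
      unfolding \<nu>(2)[symmetric] inner_real_exponent by (intro sum_mono le)
    also have "\<dots> = P $ j * real (degree \<nu>)" by (simp add: sum_distrib_left)
    finally have "min_weight c P \<le> P $ j * real (degree \<nu>)" .
    moreover have "0 < real (degree \<nu>)" using deg by (rule of_nat_0_less_iff[THEN iffD2])
    ultimately have "min_weight c P / real (degree \<nu>) \<le> P $ j"
      by (simp only: pos_divide_le_eq)
    moreover have "1 - max (vertex_bound c) (facet_bound c) \<le> 1 / real (degree \<nu>)"
      using vertex_bound_ge[OF W face] by linarith
    then have "(1 - max (vertex_bound c) (facet_bound c)) * min_weight c P \<le> 1 / real (degree \<nu>) * min_weight c P"
      using m by (intro mult_right_mono) auto
    ultimately have "(1 - max (vertex_bound c) (facet_bound c)) * min_weight c P \<le> P $ j" by simp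
    with vertex_partial_nonzero[OF P S j(1) a] show ?thesis by blast
  qed
qed

end

section \<open>Sequences in the torus\<close>

lemma common_convergent_subsequence:
  fixes g :: "'i \<Rightarrow> nat \<Rightarrow> 'b :: {real_normed_vector, heine_borel}"
  assumes "finite I" "\<And>i k. i \<in> I \<Longrightarrow> norm (g i k) \<le> 1"
  shows "\<exists>\<phi>::nat \<Rightarrow> nat. strict_mono \<phi> \<and> (\<forall>i\<in>I. convergent (\<lambda>k. g i (\<phi> k)))"
proof (rule common_subsequence[OF assms(1)])
  show "convergent (\<lambda>k. g i ((\<phi> \<circ> \<psi>) k))" if "strict_mono \<psi>" "convergent (\<lambda>k. g i (\<phi> k))"
    for i and \<phi> \<psi> :: "nat \<Rightarrow> nat"
    using convergent_subseq_convergent[OF that(2,1)] by (simp add: comp_def)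
  show "\<exists>\<psi>. strict_mono \<psi> \<and> convergent (\<lambda>k. g i ((\<phi> \<circ> \<psi>) k))" if "i \<in> I"
    for i and \<phi> :: "nat \<Rightarrow> nat"
  proof -
    have "\<forall>k. g i (\<phi> k) \<in> cball 0 1" using assms(2)[OF that] by simp
    then obtain l \<psi> where "strict_mono \<psi>" "((\<lambda>k. g i (\<phi> k)) \<circ> \<psi>) \<longlonglongrightarrow> l"
      using compact_cball[of "0::'b" 1, unfolded compact_def] by meson
    then show ?thesis by (intro exI[of _ \<psi>]) (auto simp: comp_def convergent_def)
  qed
qed

context exponent_generators
begin

text \<open>A substitute for curve selection. The index set \<open>S\<close> consists of the generators whose monomials
  have the largest order along a subsequence. The logarithmic vectors \<open>x\<^sub>k\<close> have convergent inner products with differences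
  of elements of \<open>S\<close>, so their projections \<open>w\<^sub>k\<close> to the span of these differences converge, and the
  complementary parts \<open>P\<^sub>k\<close> give equal weight to all elements of \<open>S\<close>. The bounded factor \<open>exp (-w\<^sub>k)\<close>
  is absorbed in \<open>a\<^sub>k\<close>.\<close>

lemma toric_limit:
  fixes z :: "nat \<Rightarrow> complex ^ 'n"
  assumes torus: "\<And>k. z k \<in> torus" and z0: "z \<longlonglongrightarrow> 0"
  obtains \<phi> :: "nat \<Rightarrow> nat" and a P b S where "strict_mono \<phi>"
    "\<forall>k i. z (\<phi> k) $ i = a k $ i * of_real (exp (- (P k $ i)))"
    "a \<longlonglongrightarrow> b" "b \<in> torus" "S \<subseteq> V"
    "\<forall>\<^sub>F k in sequentially. P k \<in> positive_weights \<and> initial_generators (P k) = S"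
    "\<forall>v\<in>V - S. filterlim (\<lambda>k. P k \<bullet> real_exponent v - min_weight c (P k)) at_top sequentially"
proof -
  \<comment> \<open>Relative sizes of the monomials; they add up to 1, so not all of them can tend to 0.\<close>
  define T where "T k = (\<Sum>v\<in>V. norm (monomial v (z k)))" for k
  define q where "q v k = norm (monomial v (z k)) / T k" for v k
  have mon: "0 < norm (monomial v (z k))" for v k
    using torus[of k] by (simp add: monomial_def torus_def)
  have T: "0 < T k" for k unfolding T_def using finite_V V_nonempty mon by (intro sum_pos) auto
  have q: "0 < q v k" for v k using mon T by (simp add: q_def)
  have q1: "(\<Sum>v\<in>V. q v k) = 1" for k
    using T[of k] by (simp add: q_def sum_divide_distrib[symmetric] T_def[symmetric])
  have qle: "q v k \<le> 1" if "v \<in> V" for v k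
    using member_le_sum[OF that, of "\<lambda>v. q v k"] q finite_V q1[of k] by (simp add: less_imp_le)
  obtain \<phi>1 :: "nat \<Rightarrow> nat" where \<phi>1: "strict_mono \<phi>1"
    "\<And>v. v \<in> V \<Longrightarrow> convergent (\<lambda>k. (q v (\<phi>1 k)))"
  proof -
    have "norm ((q v k)) \<le> 1" if "v \<in> V" for v k
      using qle[OF that, of k] q[of v k] by simp
    then have "\<exists>\<phi>::nat \<Rightarrow> nat. strict_mono \<phi> \<and> (\<forall>v\<in>V. convergent (\<lambda>k. (q v (\<phi> k))))"
      by (intro common_convergent_subsequence finite_V) auto
    with that show thesis by blast
  qed
  obtain \<phi>2 :: "nat \<Rightarrow> nat" where \<phi>2: "strict_mono \<phi>2"
    "\<And>i. convergent (\<lambda>k. sgn (z (\<phi>1 (\<phi>2 k)) $ i))"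
  proof -
    have "norm (sgn (z (\<phi>1 k) $ i)) \<le> 1" for k i by (simp add: norm_sgn)
    then have "\<exists>\<phi>::nat \<Rightarrow> nat. strict_mono \<phi> \<and> (\<forall>i\<in>UNIV. convergent (\<lambda>k. sgn (z (\<phi>1 (\<phi> k)) $ i)))"
      by (intro common_convergent_subsequence) auto
    with that show thesis by blast
  qed
  define \<phi> where "\<phi> = \<phi>1 \<circ> \<phi>2"
  have \<phi>: "strict_mono \<phi>" unfolding \<phi>_def by (rule strict_mono_o[OF \<phi>1(1) \<phi>2(1)])
  have "convergent (\<lambda>k. q v (\<phi> k))" if "v \<in> V" for v
    using convergent_subseq_convergent[OF \<phi>1(2)[OF that] \<phi>2(1)]
    by (simp add: \<phi>_def comp_def)
  then obtain l where l: "\<And>v. v \<in> V \<Longrightarrow> (\<lambda>k. q v (\<phi> k)) \<longlonglongrightarrow> l v"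
    unfolding convergent_def by metis
  have l0: "0 \<le> l v" if "v \<in> V" for v
    by (rule LIMSEQ_le_const[OF l[OF that]]) (use q in \<open>auto simp: less_imp_le\<close>)
  have "(\<lambda>k. \<Sum>v\<in>V. q v (\<phi> k)) \<longlonglongrightarrow> sum l V" by (intro tendsto_sum l)
  then have "sum l V = 1" by (simp add: q1 LIMSEQ_const_iff)
  define S where "S = {v \<in> V. l v \<noteq> 0}"
  have "S \<noteq> {}"
  proof
    assume "S = {}"
    then have "sum l V = 0" by (intro sum.neutral) (auto simp: S_def)
    with \<open>sum l V = 1\<close> show False by simp
  qed
  then obtain s where s: "s \<in> S" by blast
  have lS: "0 < l v" if "v \<in> S" for v using that l0[of v] by (auto simp: S_def less_le)
  have SV: "S \<subseteq> V" by (auto simp: S_def)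
  define x where "x k = (\<chi> i. - ln (norm (z (\<phi> k) $ i)))" for k
  have znz: "z k $ i \<noteq> 0" for k i using torus[of k] by (simp add: torus_def)
  have expx: "exp (- (x k $ i)) = norm (z (\<phi> k) $ i)" for k i using znz by (simp add: x_def)
  have xin: "x k \<bullet> (real_exponent v - real_exponent w) = ln (q w (\<phi> k)) - ln (q v (\<phi> k))" for k v w
  proof -
    have "ln (q u (\<phi> k)) = - (x k \<bullet> real_exponent u) - ln (T (\<phi> k))" for u
    proof -
      have "norm (monomial u (z (\<phi> k))) = exp (- (x k \<bullet> real_exponent u))"
        unfolding exp_neg_inner_real_exponent norm_monomial expx ..
      then show ?thesis using T[of "\<phi> k"] by (simp add: q_def ln_div)
    qed
    then show ?thesis by (simp add: inner_diff_right)
  qed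
  \<comment> \<open>The directions in which \<open>x\<close> stays bounded.\<close>
  define W where "W = (\<lambda>(v, w). real_exponent v - real_exponent w) ` (S \<times> S)"
  have convx: "convergent (\<lambda>k. x k \<bullet> u)" if "u \<in> span W" for u
    using that
  proof (induction rule: span_induct)
    case base
    show ?case by (auto simp: subspace_def inner_add_right convergent_const intro: convergent_add convergent_mult)
  next
    case (step u)
    then obtain v w where u: "u = real_exponent v - real_exponent w" "v \<in> S" "w \<in> S" by (auto simp: W_def)
    have "(\<lambda>k. ln (q w (\<phi> k)) - ln (q v (\<phi> k))) \<longlonglongrightarrow> ln (l w) - ln (l v)"
      using u(2,3) lS[of v] lS[of w] SV by (intro tendsto_intros l) auto
    then show ?case unfolding u(1) xin convergent_def by blast
  qed
  have "\<exists>w P. w \<in> span W \<and> (\<forall>u\<in>span W. P \<bullet> u = 0) \<and> x k = w + P" for k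
    using orthogonal_subspace_decomp_exists[of W "x k"] by (metis orthogonal_def)
  then obtain w P where wP: "\<And>k. w k \<in> span W" "\<And>k u. u \<in> span W \<Longrightarrow> P k \<bullet> u = 0"
    "\<And>k. x k = w k + P k" by metis
  have "convergent (\<lambda>k. w k \<bullet> u)" for u
  proof -
    obtain u1 u2 where u: "u1 \<in> span W" "\<And>y. y \<in> span W \<Longrightarrow> u2 \<bullet> y = 0" "u = u1 + u2"
      using orthogonal_subspace_decomp_exists[of W u] by (metis orthogonal_def)
    have "w k \<bullet> u = x k \<bullet> u1" for k
      using wP(2)[OF u(1), of k] u(2)[OF wP(1), of k]
      by (simp add: u(3) wP(3) inner_add_left inner_add_right inner_commute)
    with convx[OF u(1)] show ?thesis by simp
  qed
  note convw = this
  then have "\<forall>i. \<exists>t. (\<lambda>k. w k $ i) \<longlonglongrightarrow> t"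
    using convw[of "axis _ 1"] by (simp add: convergent_def inner_axis)
  then obtain w' where w': "\<And>i. (\<lambda>k. w k $ i) \<longlonglongrightarrow> w' i" by metis
  from \<phi>2(2) have "\<forall>i. \<exists>t. (\<lambda>k. sgn (z (\<phi> k) $ i)) \<longlonglongrightarrow> t" by (simp add: convergent_def \<phi>_def)
  then obtain \<sigma> where \<sigma>: "\<And>i. (\<lambda>k. sgn (z (\<phi> k) $ i)) \<longlonglongrightarrow> \<sigma> i" by metis
  have \<sigma>1: "\<sigma> i \<noteq> 0" for i
  proof -
    have "(\<lambda>k. norm (sgn (z (\<phi> k) $ i))) \<longlonglongrightarrow> norm (\<sigma> i)" by (intro tendsto_norm \<sigma>)
    then have "norm (\<sigma> i) = 1" using znz by (simp add: norm_sgn LIMSEQ_const_iff)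
    then show ?thesis by auto
  qed
  define a where "a k = (\<chi> i. sgn (z (\<phi> k) $ i) * of_real (exp (- (w k $ i))))" for k
  define b where "b = (\<chi> i. \<sigma> i * of_real (exp (- w' i)))"
  have za: "z (\<phi> k) $ i = a k $ i * of_real (exp (- (P k $ i)))" for k i
  proof -
    have "exp (- (w k $ i)) * exp (- (P k $ i)) = norm (z (\<phi> k) $ i)"
      unfolding expx[symmetric] wP(3) by (simp add: exp_add[symmetric])
    then have "complex_of_real (exp (- (w k $ i))) * of_real (exp (- (P k $ i))) = of_real (norm (z (\<phi> k) $ i))"
      by (metis of_real_mult)
    then show ?thesis using znz[of "\<phi> k" i]
      by (simp add: a_def mult.assoc sgn_div_norm scaleR_conv_of_real divide_inverse)
  qed
  have ab: "a \<longlonglongrightarrow> b"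
    by (rule vec_tendstoI) (auto simp: a_def b_def intro!: tendsto_intros \<sigma> w')
  have bt: "b \<in> torus" using \<sigma>1 by (simp add: b_def torus_def)
  have Ptop: "filterlim (\<lambda>k. P k $ i) at_top sequentially" for i
  proof -
    have "(\<lambda>k. z (\<phi> k) $ i) \<longlonglongrightarrow> (0 :: complex ^ 'n) $ i"
      using LIMSEQ_subseq_LIMSEQ[OF z0 \<phi>] by (intro tendsto_vec_nth) (simp add: comp_def)
    then have "(\<lambda>k. norm (z (\<phi> k) $ i)) \<longlonglongrightarrow> 0" by (simp add: tendsto_norm_zero)
    then have "filterlim (\<lambda>k. norm (z (\<phi> k) $ i)) (at_right 0) sequentially"
      using znz by (simp add: filterlim_at)
    then have "filterlim (\<lambda>k. ln (norm (z (\<phi> k) $ i))) at_bot sequentially"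
      by (rule filterlim_compose[OF ln_at_0])
    then have "filterlim (\<lambda>k. x k $ i) at_top sequentially" by (simp add: x_def filterlim_uminus_at_top)
    then have "filterlim (\<lambda>k. - (w k $ i) + x k $ i) at_top sequentially"
      by (rule filterlim_tendsto_add_at_top[OF tendsto_minus[OF w'[of i]]])
    then show ?thesis by (simp add: wP(3))
  qed
  have PS: "P k \<bullet> real_exponent v = P k \<bullet> real_exponent s" if "v \<in> S" for v k
  proof -
    have "real_exponent v - real_exponent s \<in> span W"
      using that s by (intro span_base) (auto simp: W_def)
    from wP(2)[OF this, of k] show ?thesis by (simp add: inner_diff_right)
  qed
  have PV: "filterlim (\<lambda>k. P k \<bullet> real_exponent v - P k \<bullet> real_exponent s) at_top sequentially"
    if v: "v \<in> V - S" for v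
  proof -
    let ?u = "real_exponent v - real_exponent s"
    have lv: "l v = 0" using v by (simp add: S_def)
    have "filterlim (\<lambda>k. q v (\<phi> k)) (at_right 0) sequentially"
      using l[of v] v q lv by (simp add: filterlim_at less_imp_neq[symmetric])
    then have "filterlim (\<lambda>k. ln (q v (\<phi> k))) at_bot sequentially"
      by (rule filterlim_compose[OF ln_at_0])
    then have top: "filterlim (\<lambda>k. - ln (q v (\<phi> k))) at_top sequentially" by (simp add: filterlim_uminus_at_top)
    have lns: "(\<lambda>k. ln (q s (\<phi> k))) \<longlonglongrightarrow> ln (l s)"
      using s lS[of s] SV by (intro tendsto_intros l) auto
    obtain t where "(\<lambda>k. w k \<bullet> ?u) \<longlonglongrightarrow> t" using convw unfolding convergent_def by blast
    then have "(\<lambda>k. ln (q s (\<phi> k)) - w k \<bullet> ?u) \<longlonglongrightarrow> ln (l s) - t" by (intro tendsto_diff lns)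
    from filterlim_tendsto_add_at_top[OF this top]
    have "filterlim (\<lambda>k. x k \<bullet> ?u - w k \<bullet> ?u) at_top sequentially"
      unfolding xin by (simp add: algebra_simps)
    then show ?thesis by (simp add: wP(3) inner_add_left inner_diff_right[symmetric])
  qed
  have ev: "\<forall>\<^sub>F k in sequentially. (\<forall>i. 0 < P k $ i) \<and> (\<forall>v\<in>V - S. 0 < P k \<bullet> real_exponent v - P k \<bullet> real_exponent s)"
    using Ptop[unfolded filterlim_at_top_dense] PV[unfolded filterlim_at_top_dense] finite_V
    by (intro eventually_conj eventually_all_finite eventually_ball_finite ballI) blast+
  have good: "P k \<in> positive_weights \<and> initial_generators (P k) = S \<and> min_weight c (P k) = P k \<bullet> real_exponent s"
    if k: "\<forall>i. 0 < P k $ i" "\<forall>v\<in>V - S. 0 < P k \<bullet> real_exponent v - P k \<bullet> real_exponent s" for k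
  proof -
    have pos: "P k \<in> positive_weights"
      using k(1) by (auto simp: positive_weights_def weights_def vanishing_indices_def less_imp_le less_imp_neq[symmetric])
    then have W: "P k \<in> weights" by (simp add: positive_weights_def)
    have ge: "P k \<bullet> real_exponent s \<le> P k \<bullet> real_exponent v" if "v \<in> V" for v
      using PS[of v k] k(2) that by (cases "v \<in> S") (auto simp: less_imp_le)
    have "min_weight c (P k) = P k \<bullet> real_exponent s"
      using min_weight_attained[OF W] ge min_weight_le_V[OF W, of s] s SV by (metis antisym subsetD)
    moreover have "P k \<bullet> real_exponent v = P k \<bullet> real_exponent s \<longleftrightarrow> v \<in> S" if "v \<in> V" for v
      using PS[of v k] k(2)[rule_format, of v] that by (cases "v \<in> S") auto
    then have "initial_generators (P k) = S"
      unfolding initial_generators_def calculation using SV by blast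
    ultimately show ?thesis using pos by blast
  qed
  show thesis
  proof (rule that[OF \<phi> _ ab bt SV _ ballI])
    show "\<forall>k i. z (\<phi> k) $ i = a k $ i * of_real (exp (- (P k $ i)))" using za by blast
    show "\<forall>\<^sub>F k in sequentially. P k \<in> positive_weights \<and> initial_generators (P k) = S"
      using ev by eventually_elim (use good in blast)
    show "filterlim (\<lambda>k. P k \<bullet> real_exponent v - min_weight c (P k)) at_top sequentially" if "v \<in> V - S" for v
    proof (rule filterlim_cong[THEN iffD1, OF refl refl _ PV[OF that]])
      show "\<forall>\<^sub>F k in sequentially. P k \<bullet> real_exponent v - P k \<bullet> real_exponent s =
          P k \<bullet> real_exponent v - min_weight c (P k)"
        using ev by eventually_elim (use good in simp)
    qed
  qed
qed

end

section \<open>The gradient inequality\<close>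

context tame_series
begin

text \<open>A sequence violating the inequality is written as \<open>a\<^sub>k exp (-P\<^sub>k)\<close>. The set \<open>J\<close> collects the
  indices with \<open>\<partial>\<^sub>jf\<^sub>P(b) \<noteq> 0\<close>; it is the same for all large \<open>k\<close>, while the index \<open>j \<in> J\<close> supplied
  by \<open>tame_weight_bound\<close> may depend on \<open>k\<close>. The estimates are therefore made uniform over the finite set \<open>J\<close>.\<close>

lemma gradient_inequality_torus:
  assumes \<theta>: "max (vertex_bound c) (facet_bound c) \<le> \<theta>"
  shows "\<exists>K>0. \<forall>\<^sub>F z in nhds 0. z \<in> torus \<longrightarrow>
    K * norm (pseries c z) powr \<theta> \<le> norm (gradient (pseries c) z)"
proof (rule ccontr)
  let ?f = "pseries c"
  assume no: "\<not> ?thesis"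
  have "\<exists>z. z \<in> torus \<and> norm z < inverse (real (Suc k)) \<and>
      norm (gradient ?f z) < inverse (real (Suc k)) * norm (?f z) powr \<theta>" for k
  proof -
    have "\<not> (\<forall>\<^sub>F z in nhds 0. z \<in> torus \<longrightarrow>
        inverse (real (Suc k)) * norm (?f z) powr \<theta> \<le> norm (gradient ?f z))"
    proof
      assume "\<forall>\<^sub>F z in nhds 0. z \<in> torus \<longrightarrow>
        inverse (real (Suc k)) * norm (?f z) powr \<theta> \<le> norm (gradient ?f z)"
      moreover have "0 < inverse (real (Suc k))" by simp
      ultimately show False using no by blast
    qed
    then have "\<forall>d>0. \<exists>z. dist z 0 < d \<and> \<not> (z \<in> torus \<longrightarrow>
        inverse (real (Suc k)) * norm (?f z) powr \<theta> \<le> norm (gradient ?f z))"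
      unfolding eventually_nhds_metric by blast
    from this[rule_format, of "inverse (real (Suc k))"] show ?thesis
      by (auto simp: not_le)
  qed
  then obtain z where z: "\<And>k. z k \<in> torus" "\<And>k. norm (z k) < inverse (real (Suc k))"
    "\<And>k. norm (gradient ?f (z k)) < inverse (real (Suc k)) * norm (?f (z k)) powr \<theta>" by metis
  have z0: "z \<longlonglongrightarrow> 0"
    by (rule Lim_null_comparison[OF _ LIMSEQ_inverse_real_of_nat])
       (use z(2) in \<open>auto intro!: always_eventually less_imp_le\<close>)
  from toric_limit[OF z(1) z0] obtain \<phi> :: "nat \<Rightarrow> nat" and a P b S where \<phi>: "strict_mono \<phi>"
    and za: "\<forall>k i. z (\<phi> k) $ i = a k $ i * of_real (exp (- (P k $ i)))"
    and ab: "a \<longlonglongrightarrow> b" and b: "b \<in> torus" and SV: "S \<subseteq> V"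
    and good: "\<forall>\<^sub>F k in sequentially. P k \<in> positive_weights \<and> initial_generators (P k) = S"
    and notS: "\<forall>v\<in>V - S.
      filterlim (\<lambda>k. P k \<bullet> real_exponent v - min_weight c (P k)) at_top sequentially" .
  define m where "m k = min_weight c (P k)" for k
  have z\<phi>0: "(\<lambda>k. z (\<phi> k)) \<longlonglongrightarrow> 0" using LIMSEQ_subseq_LIMSEQ[OF z0 \<phi>] by (simp add: comp_def)
  have inS: "\<forall>\<^sub>F k in sequentially. P k \<bullet> real_exponent v = m k" if "v \<in> S" for v
    using good by eventually_elim (use that in \<open>auto simp: m_def initial_generators_def\<close>)
  have lim: "(\<lambda>k. of_real (exp (m k)) * pseries d (z (\<phi> k))) \<longlonglongrightarrow> (\<Sum>\<nu>\<in>S. d \<nu> * monomial \<nu> b)"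
    if "converges_at d s" "0 < s" "\<And>\<nu>. d \<nu> \<noteq> 0 \<Longrightarrow> c \<nu> \<noteq> 0" for d s
    by (rule pseries_tendsto_initial_form[OF finite_V SV _ that(1,2) za[rule_format] ab z\<phi>0 inS notS[folded m_def, rule_format]])
       (use V_dominates that(3) in blast)
  \<comment> \<open>The limits of the scaled values of \<open>f\<close> and \<open>z\<^sub>j \<partial>\<^sub>jf\<close>: the initial form at \<open>b\<close> and its logarithmic derivatives.\<close>
  define L where "L = (\<Sum>\<nu>\<in>S. c \<nu> * monomial \<nu> b)"
  define g where "g j = (\<Sum>\<nu>\<in>S. c \<nu> * of_nat (\<nu> $ j) * monomial \<nu> b)" for j
  have f_lim: "(\<lambda>k. of_real (exp (m k)) * ?f (z (\<phi> k))) \<longlonglongrightarrow> L"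
    unfolding L_def by (rule lim[OF conv r_pos])
  have g_lim: "(\<lambda>k. of_real (exp (m k)) * pseries (\<lambda>\<nu>. c \<nu> * of_nat (\<nu> $ j)) (z (\<phi> k))) \<longlonglongrightarrow> g j" for j
    unfolding g_def using r_pos by (intro lim[OF converges_at_mult_exponent[OF conv]]) auto
  have small: "\<forall>\<^sub>F k in sequentially. norm (z (\<phi> k)) < r"
    using order_tendstoD(2)[OF tendsto_norm[OF z\<phi>0], of r] r_pos by simp
  \<comment> \<open>The summand 1 makes the limits of the bounded quantities lie strictly below their bounds.\<close>
  define C where "C = norm L + 1"
  have C: "0 < C" unfolding C_def by (rule add_nonneg_pos) auto
  have f_bd: "\<forall>\<^sub>F k in sequentially. exp (m k) * norm (?f (z (\<phi> k))) < C"
    using order_tendstoD(2)[OF tendsto_norm[OF f_lim], of C] by (simp add: C_def norm_mult)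
  define A where "A j = norm (b $ j) + 1" for j
  have A: "0 < A j" for j unfolding A_def by (rule add_nonneg_pos) auto
  have a_bd: "\<forall>\<^sub>F k in sequentially. norm (a k $ j) < A j" for j
    using order_tendstoD(2)[OF tendsto_norm[OF tendsto_vec_nth[OF ab]], of j "A j"] by (simp add: A_def)
  define J where "J = {j. g j \<noteq> 0}"
  have g_bd: "\<forall>\<^sub>F k in sequentially. norm (g j) / 2 <
      exp (m k) * norm (pseries (\<lambda>\<nu>. c \<nu> * of_nat (\<nu> $ j)) (z (\<phi> k)))" if "j \<in> J" for j
    using order_tendstoD(1)[OF tendsto_norm[OF g_lim], of "norm (g j) / 2" j] that
    by (simp add: J_def norm_mult)
  have tiny: "\<forall>\<^sub>F k in sequentially. inverse (real (Suc (\<phi> k))) * C powr \<theta> < norm (g j) / 2 / A j"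
    if "j \<in> J" for j
  proof -
    have "(\<lambda>k. inverse (real (Suc (\<phi> k))) * C powr \<theta>) \<longlonglongrightarrow> 0 * C powr \<theta>"
      using LIMSEQ_subseq_LIMSEQ[OF LIMSEQ_inverse_real_of_nat \<phi>]
      by (intro tendsto_intros) (simp add: comp_def)
    from order_tendstoD(2)[OF this] that A[of j] show ?thesis by (simp add: J_def)
  qed
  have "\<forall>\<^sub>F k in sequentially. \<forall>j\<in>J. norm (g j) / 2 <
      exp (m k) * norm (pseries (\<lambda>\<nu>. c \<nu> * of_nat (\<nu> $ j)) (z (\<phi> k)))
      \<and> inverse (real (Suc (\<phi> k))) * C powr \<theta> < norm (g j) / 2 / A j \<and> norm (a k $ j) < A j"
    by (intro eventually_ball_finite ballI eventually_conj g_bd tiny a_bd) auto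
  with good small f_bd have "\<forall>\<^sub>F k in sequentially. False"
  proof eventually_elim
    case (elim k)
    let ?z = "z (\<phi> k)"
    have P: "P k \<in> positive_weights" and S: "initial_generators (P k) = S" using elim(1) by auto
    from tame_weight_bound[OF P b] obtain j where j: "partial (face_fun c (P k)) j b \<noteq> 0"
      "(1 - max (vertex_bound c) (facet_bound c)) * m k \<le> P k $ j" unfolding m_def by blast
    have "g j = b $ j * partial (face_fun c (P k)) j b"
      unfolding euler_face_fun_positive[OF P] S g_def ..
    with j(1) b have jJ: "j \<in> J" by (simp add: J_def torus_def)
    have m: "0 < m k" unfolding m_def by (rule min_weight_pos[OF P])
    have \<theta>P: "(1 - \<theta>) * m k \<le> P k $ j"
      using mult_right_mono[of "1 - \<theta>" "1 - max (vertex_bound c) (facet_bound c)" "m k"] \<theta> m j(2) by linarith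
    have zr: "norm (?z $ i) < r" for i
      using Finite_Cartesian_Product.norm_nth_le[of ?z i] elim(2) by linarith
    have "norm (g j) / 2 < exp (m k) * norm (pseries (\<lambda>\<nu>. c \<nu> * of_nat (\<nu> $ j)) ?z)"
      using elim(4) jJ by blast
    also have "\<dots> = exp (m k) * (norm (?z $ j) * norm (partial ?f j ?z))"
      unfolding euler_partial_pseries[OF conv zr, symmetric] norm_mult ..
    also have "norm (?z $ j) = norm (a k $ j) * exp (- (P k $ j))" by (simp add: za norm_mult)
    also have "exp (m k) * (norm (a k $ j) * exp (- (P k $ j)) * norm (partial ?f j ?z)) \<le>
        exp (m k) * (A j * exp (- (P k $ j)) * norm (gradient ?f ?z))"
    proof (intro mult_left_mono mult_mono)
      show "norm (a k $ j) \<le> A j" using elim(4) jJ by (simp add: less_imp_le)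
      show "norm (partial ?f j ?z) \<le> norm (gradient ?f ?z)"
        using Finite_Cartesian_Product.norm_nth_le[of "gradient ?f ?z" j] by (simp add: gradient_def)
    qed (use A[of j] in \<open>auto simp: less_imp_le\<close>)
    also have "norm (gradient ?f ?z) \<le> inverse (real (Suc (\<phi> k))) * norm (?f ?z) powr \<theta>"
      using z(3)[of "\<phi> k"] by simp
    also have "norm (?f ?z) powr \<theta> \<le> C powr \<theta> * exp (- (\<theta> * m k))"
    proof -
      have "norm (?f ?z) \<le> C * exp (- m k)"
        using elim(3) by (simp add: exp_minus field_simps)
      moreover have "0 \<le> \<theta>" using \<theta> vertex_bound_range(1) by linarith
      ultimately have "norm (?f ?z) powr \<theta> \<le> (C * exp (- m k)) powr \<theta>" by (intro powr_mono2) auto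
      also have "\<dots> = C powr \<theta> * exp (- (\<theta> * m k))"
        using C by (simp add: powr_mult exp_powr_real mult.commute)
      finally show ?thesis .
    qed
    finally have "norm (g j) / 2 <
        exp (m k) * (A j * exp (- (P k $ j)) * (inverse (real (Suc (\<phi> k))) * (C powr \<theta> * exp (- (\<theta> * m k)))))"
      using A[of j] by (simp add: mult_left_mono)
    also have "\<dots> = exp ((1 - \<theta>) * m k - P k $ j) * (A j * (inverse (real (Suc (\<phi> k))) * C powr \<theta>))"
    proof -
      have "exp ((1 - \<theta>) * m k - P k $ j) = exp (m k) * exp (- (P k $ j)) * exp (- (\<theta> * m k))"
        by (simp add: exp_add[symmetric] algebra_simps)
      then show ?thesis by (simp only: mult_ac)
    qed
    also have "\<dots> \<le> 1 * (A j * (inverse (real (Suc (\<phi> k))) * C powr \<theta>))"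
      using \<theta>P A[of j] by (intro mult_right_mono) auto
    also have "\<dots> < A j * (norm (g j) / 2 / A j)"
      using elim(4) jJ A[of j] by (simp only: mult_1) (intro mult_strict_left_mono, auto)
    also have "\<dots> = norm (g j) / 2" using A[of j] by simp
    finally show False by simp
  qed
  then show False by simp
qed

text \<open>Points on the coordinate hyperplanes are limits of points of the torus. Where \<open>f\<close> vanishes the inequality is
  trivial, and elsewhere \<open>|f|\<close> to the power \<open>\<theta>\<close> is continuous even for \<open>\<theta> = 0\<close>.\<close>

lemma gradient_inequality:
  assumes \<theta>: "max (vertex_bound c) (facet_bound c) \<le> \<theta>"
  shows "\<exists>K>0. \<forall>\<^sub>F z in nhds 0. K * norm (pseries c z) powr \<theta> \<le> norm (gradient (pseries c) z)"
proof -
  let ?f = "pseries c"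
  from gradient_inequality_torus[OF \<theta>] obtain K \<epsilon> where K: "0 < K" and \<epsilon>: "0 < \<epsilon>"
    and ineq: "\<And>z. norm z < \<epsilon> \<Longrightarrow> z \<in> torus \<Longrightarrow> K * norm (?f z) powr \<theta> \<le> norm (gradient ?f z)"
    unfolding eventually_nhds_metric by auto
  have "K * norm (?f z) powr \<theta> \<le> norm (gradient ?f z)" if z: "norm z < min \<epsilon> (r / 2)" for z
  proof (cases "?f z = 0")
    case False
    define w where "w k = (\<chi> i. if z $ i = 0 then of_real (inverse (real (Suc k))) else z $ i)" for k
    have w: "w \<longlonglongrightarrow> z"
    proof (rule vec_tendstoI)
      fix i
      have "(\<lambda>k. complex_of_real (inverse (real (Suc k)))) \<longlonglongrightarrow> of_real 0"
        by (intro tendsto_of_real LIMSEQ_inverse_real_of_nat)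
      then show "(\<lambda>k. w k $ i) \<longlonglongrightarrow> z $ i" by (cases "z $ i = 0") (simp_all add: w_def)
    qed
    have wt: "w k \<in> torus" for k
      unfolding torus_def w_def by (auto simp del: of_nat_Suc)
    have w_small: "\<forall>\<^sub>F k in sequentially. norm (w k) < min \<epsilon> (r / 2)"
      by (rule order_tendstoD(2)[OF tendsto_norm[OF w] z])
    let ?D = "{z :: complex ^ 'n. \<forall>i. norm (z $ i) \<le> r / 2}"
    have D: "u \<in> ?D" if "norm u < min \<epsilon> (r / 2)" for u
    proof -
      have "norm (u $ i) \<le> r / 2" for i
        using that Finite_Cartesian_Product.norm_nth_le[of u i] by linarith
      then show ?thesis by simp
    qed
    have evD: "\<forall>\<^sub>F k in sequentially. w k \<in> ?D" using w_small by eventually_elim (rule D)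
    have "continuous_on ?D ?f"
      using r_pos by (intro continuous_on_pseries converges_at_mono[OF conv]) auto
    from continuous_on_tendsto_compose[OF this w D[OF z] evD]
    have fw: "(\<lambda>k. ?f (w k)) \<longlonglongrightarrow> ?f z" .
    have gw: "(\<lambda>k. gradient ?f (w k)) \<longlonglongrightarrow> gradient ?f z"
      by (rule vec_tendstoI)
         (simp add: gradient_def
            continuous_on_tendsto_compose[OF continuous_on_partial_pseries[OF conv r_pos] w D[OF z] evD])
    show ?thesis
    proof (rule tendsto_le[OF sequentially_bot tendsto_norm[OF gw]])
      show "(\<lambda>k. K * norm (?f (w k)) powr \<theta>) \<longlonglongrightarrow> K * norm (?f z) powr \<theta>"
        using False by (intro tendsto_intros fw) auto
      show "\<forall>\<^sub>F k in sequentially. K * norm (?f (w k)) powr \<theta> \<le> norm (gradient ?f (w k))"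
        using w_small by eventually_elim (rule ineq, auto simp: wt)
    qed
  qed simp
  then show ?thesis
    using K \<epsilon> r_pos unfolding eventually_nhds_metric
    by (intro exI[of _ K] conjI exI[of _ "min \<epsilon> (r / 2)"]) auto
qed

end

text \<open>Summability at one point with all coordinates equal to \<open>r\<close> is absolute summability on the polydisc of
  radius \<open>r\<close>. Derivatives at a point depend only on nearby values.\<close>

lemma has_power_series_pseries:
  fixes f :: "complex ^ 'n \<Rightarrow> complex"
  assumes "has_power_series f c"
  obtains r where "0 < r" "converges_at c r"
    "\<forall>\<^sub>F z in nhds 0. f z = pseries c z \<and> gradient f z = gradient (pseries c) z"
proof -
  from assms obtain e where e: "0 < e"
    and sums: "\<And>z. norm z < e \<Longrightarrow> ((\<lambda>\<nu>. c \<nu> * monomial \<nu> z) has_sum f z) UNIV"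
    unfolding has_power_series_def eventually_nhds_metric by auto
  define u :: "complex ^ 'n" where "u = (\<chi> i. 1)"
  define r where "r = e / (norm u + 1)"
  have n: "0 < norm u + 1" by (rule add_nonneg_pos) auto
  have r: "0 < r" using e n by (simp add: r_def)
  have "norm (r *\<^sub>R u) < e"
    using e n r by (simp add: r_def field_simps)
  then have "(\<lambda>\<nu>. c \<nu> * monomial \<nu> (r *\<^sub>R u)) summable_on UNIV" using sums has_sum_imp_summable by blast
  then have "(\<lambda>\<nu>. norm (c \<nu> * monomial \<nu> (r *\<^sub>R u))) summable_on UNIV"
    by (simp add: summable_on_iff_abs_summable_on_complex)
  moreover have "norm (c \<nu> * monomial \<nu> (r *\<^sub>R u)) = norm (c \<nu>) * r ^ degree \<nu>" for \<nu>
    using r by (simp add: norm_mult norm_monomial u_def power_sum)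
  ultimately have conv: "converges_at c r" by (simp add: converges_at_def)
  have eq: "f z = pseries c z" if "norm z < e" for z
    using infsumI[OF sums[OF that]] by (simp add: pseries_def)
  have "partial f j z = partial (pseries c) j z" if z: "norm z < e" for j z
    unfolding partial_def
  proof (rule deriv_cong_ev[OF _ refl])
    let ?L = "\<lambda>w. (\<chi> i. if i = j then w else z $ i)"
    have "(?L \<longlongrightarrow> z) (nhds (z $ j))"
    proof (rule vec_tendstoI)
      show "((\<lambda>w. ?L w $ i) \<longlongrightarrow> z $ i) (nhds (z $ j))" for i
        by (cases "i = j") (simp_all add: filterlim_ident)
    qed
    from order_tendstoD(2)[OF tendsto_norm[OF this] z]
    show "\<forall>\<^sub>F w in nhds (z $ j). f (?L w) = pseries c (?L w)" by eventually_elim (rule eq)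
  qed
  then have "f z = pseries c z \<and> gradient f z = gradient (pseries c) z" if "norm z < e" for z
    using that eq by (simp add: gradient_def)
  then have "\<forall>\<^sub>F z in nhds 0. f z = pseries c z \<and> gradient f z = gradient (pseries c) z"
    using e unfolding eventually_nhds_metric by (intro exI[of _ e]) auto
  with r conv show thesis by (rule that)
qed

theorem theorem22:
  fixes f :: "complex ^ 'n \<Rightarrow> complex" and c :: "nat ^ 'n \<Rightarrow> complex"
  assumes "has_power_series f c"
    and "f 0 = 0"
    and "\<not> (\<forall>\<^sub>F z in nhds 0. f z = 0)"
    and "nondegenerate c"
    and "strongly_inv_tame c"
  shows "lojasiewicz_exponent f \<le> ereal (max (vertex_bound c) (facet_bound c))"
proof -
  obtain r where r: "0 < r" "converges_at c r"
    and f: "\<forall>\<^sub>F z in nhds 0. f z = pseries c z \<and> gradient f z = gradient (pseries c) z"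
    using has_power_series_pseries[OF assms(1)] .
  have ps0: "pseries c 0 = c 0"
  proof -
    have "monomial \<nu> 0 = (if \<nu> = 0 then 1 else (0 :: complex))" for \<nu> :: "nat ^ 'n"
      by (auto simp: monomial_def vec_eq_iff)
    then have "pseries c 0 = (\<Sum>\<^sub>\<infinity>\<nu>\<in>{0}. c \<nu>)"
      unfolding pseries_def by (intro infsum_cong_neutral) auto
    then show ?thesis by simp
  qed
  have "f 0 = pseries c 0" using eventually_nhds_x_imp_x[OF f] by simp
  with ps0 assms(2) have c0: "c 0 = 0" by simp
  obtain V where V: "finite V" "V \<subseteq> {\<nu>. c \<nu> \<noteq> 0}" "\<forall>\<nu>\<in>{\<nu>. c \<nu> \<noteq> 0}. \<exists>v\<in>V. \<forall>i. v $ i \<le> \<nu> $ i"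
    using dickson[of "{\<nu>. c \<nu> \<noteq> 0}"] by blast
  have "V \<noteq> {}"
  proof
    assume "V = {}"
    with V(3) have "c \<nu> = 0" for \<nu> by blast
    then have "pseries c z = 0" for z by (simp add: pseries_def)
    with f assms(3) show False by (simp add: eventually_mono)
  qed
  then interpret tame_series c V r
    by unfold_locales (use V r c0 assms(5) in auto)
  let ?\<theta> = "max (vertex_bound c) (facet_bound c)"
  from gradient_inequality[OF order_refl] obtain K where K: "0 < K"
    "\<forall>\<^sub>F z in nhds 0. K * norm (pseries c z) powr ?\<theta> \<le> norm (gradient (pseries c) z)" by blast
  from K(2) f have "\<forall>\<^sub>F z in nhds 0. norm (gradient f z) \<ge> K * norm (f z) powr ?\<theta>"
    by eventually_elim simp
  moreover have "0 \<le> ?\<theta>" "?\<theta> < 1" using vertex_bound_range facet_bound_less_1 by auto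
  ultimately show ?thesis
    unfolding lojasiewicz_exponent_def using K(1) by (intro INF_lower) blast
qed

end
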